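(* For any unit-length graph $G=(V,E)$ on $n=|V|$ nodes and $m=|E|$ edges with doubling dimension $\alpha$ and diameter $\Delta$, and for any $\epsilon>0$, there exists a $(1+\epsilon)$--approximate distance oracle for $G$ using space $O(m)$ and query time $(\lg\Delta)^{O(\alpha)}\cdot(1/\epsilon)^{O(\alpha^2)}$.
   Context: A unit-length graph is an undirected graph in which every edge has length $1$; $d_G(u,v)$ is the shortest-path (hop) distance. The doubling constant $\lambda$ of $G$ is the smallest integer such that every ball of radius $2r$ in the shortest-path metric of $G$ can be covered by $\lambda$ balls of radius $r$; the doubling dimension is $\alpha=\lg_2\lambda$. A $(1+\epsilon)$--approximate distance oracle for $G$ is a data structure, built from $G$ in a preprocessing step, that given any query pair of nodes $(s,t)$ returns a value $\tilde d(s,t)$ with $d_G(s,t)\le \tilde d(s,t)\le (1+\epsilon)\,d_G(s,t)$. Its complexity measures are the space occupied by the data structure and the query time. *)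

theory Defs
  imports Complex_Main
begin

section \<open>Unit-length graphs\<close>

definition unit_length_graph :: "'a set \<Rightarrow> 'a set set \<Rightarrow> bool" where
  "unit_length_graph V E \<longleftrightarrow> finite V \<and> V \<noteq> {} \<and> (\<forall>e\<in>E. e \<subseteq> V \<and> card e = 2)"

definition adj :: "'a set set \<Rightarrow> ('a \<times> 'a) set" where
  "adj E = {(u, v). {u, v} \<in> E}"

definition connected_graph :: "'a set \<Rightarrow> 'a set set \<Rightarrow> bool" where
  "connected_graph V E \<longleftrightarrow> (\<forall>u\<in>V. \<forall>v\<in>V. (u, v) \<in> (adj E)\<^sup>*)"

text \<open>Only meaningful for nodes in the same connected component.\<close>
definition hop_dist :: "'a set set \<Rightarrow> 'a \<Rightarrow> 'a \<Rightarrow> nat" where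
  "hop_dist E u v = (LEAST k. (u, v) \<in> adj E ^^ k)"

definition diameter :: "'a set \<Rightarrow> 'a set set \<Rightarrow> nat" where
  "diameter V E = Max {hop_dist E u v | u v. u \<in> V \<and> v \<in> V}"

text \<open>Balls are closed and have arbitrary real radius; in particular \<open>r = 1/2\<close> is allowed in
  the definition of the doubling constant.\<close>
definition hop_ball :: "'a set \<Rightarrow> 'a set set \<Rightarrow> 'a \<Rightarrow> real \<Rightarrow> 'a set" where
  "hop_ball V E v r = {u \<in> V. real (hop_dist E v u) \<le> r}"

definition doubling_constant :: "'a set \<Rightarrow> 'a set set \<Rightarrow> nat" where
  "doubling_constant V E = (LEAST k. \<forall>v\<in>V. \<forall>r\<ge>0. \<exists>S\<subseteq>V. card S \<le> k \<and>
     hop_ball V E v (2 * r) \<subseteq> (\<Union>c\<in>S. hop_ball V E c r))"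

definition doubling_dimension :: "'a set \<Rightarrow> 'a set set \<Rightarrow> real" where
  "doubling_dimension V E = log 2 (real (doubling_constant V E))"


section \<open>A word RAM\<close>

text \<open>Structured programs over registers and a random-access memory, both holding words of
  \<open>w\<close> bits (naturals below \<open>2 ^ w\<close>). The word size is a parameter of the semantics, so that a single
  program can be run at every word size. Arithmetic is modulo \<open>2 ^ w\<close>; every operation,
  operand, memory access, assignment and test costs one time unit.\<close>

datatype binop = Add | Sub | Mul | Div | And | Or | Xor | Shl | Shr | Eq | Less

datatype exp =
    Const nat
  | Reg nat
  | Load exp
  | Bin binop exp exp

datatype com =
    Assign nat exp
  | Store exp exp
  | Seq com com
  | If exp com com
  | While exp com

type_synonym state = "(nat \<Rightarrow> nat) \<times> (nat \<Rightarrow> nat)"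

text \<open>For \<open>a, b < 2 ^ w\<close>, the value of \<open>Sub\<close> is \<open>a - b\<close> modulo \<open>2 ^ w\<close>.
  Division by zero yields 0.\<close>
fun binop_val :: "nat \<Rightarrow> binop \<Rightarrow> nat \<Rightarrow> nat \<Rightarrow> nat" where
  "binop_val w Add a b = (a + b) mod 2 ^ w"
| "binop_val w Sub a b = (a + 2 ^ w - b) mod 2 ^ w"
| "binop_val w Mul a b = (a * b) mod 2 ^ w"
| "binop_val w Div a b = (a div b) mod 2 ^ w"
| "binop_val w And a b = Bit_Operations.and a b mod 2 ^ w"
| "binop_val w Or a b = Bit_Operations.or a b mod 2 ^ w"
| "binop_val w Xor a b = Bit_Operations.xor a b mod 2 ^ w"
| "binop_val w Shl a b = push_bit b a mod 2 ^ w"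
| "binop_val w Shr a b = drop_bit b a mod 2 ^ w"
| "binop_val w Eq a b = (if a = b then 1 else 0) mod 2 ^ w"
| "binop_val w Less a b = (if a < b then 1 else 0) mod 2 ^ w"

fun exp_val :: "nat \<Rightarrow> exp \<Rightarrow> state \<Rightarrow> nat" where
  "exp_val w (Const k) \<sigma> = k mod 2 ^ w"
| "exp_val w (Reg i) \<sigma> = fst \<sigma> i"
| "exp_val w (Load e) \<sigma> = snd \<sigma> (exp_val w e \<sigma>)"
| "exp_val w (Bin f e1 e2) \<sigma> = binop_val w f (exp_val w e1 \<sigma>) (exp_val w e2 \<sigma>)"

fun exp_cost :: "exp \<Rightarrow> nat" where
  "exp_cost (Const k) = 1"
| "exp_cost (Reg i) = 1"
| "exp_cost (Load e) = 1 + exp_cost e"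
| "exp_cost (Bin f e1 e2) = 1 + exp_cost e1 + exp_cost e2"

text \<open>\<open>exec w c \<sigma> \<tau> \<sigma>'\<close>: at word size \<open>w\<close>, started in \<open>\<sigma>\<close>, the program \<open>c\<close>
  terminates in \<open>\<sigma>'\<close> after \<open>\<tau>\<close> time units.\<close>
inductive exec :: "nat \<Rightarrow> com \<Rightarrow> state \<Rightarrow> nat \<Rightarrow> state \<Rightarrow> bool" for w where
  Assign: "exec w (Assign i e) \<sigma> (1 + exp_cost e) ((fst \<sigma>)(i := exp_val w e \<sigma>), snd \<sigma>)"
| Store: "exec w (Store a e) \<sigma> (1 + exp_cost a + exp_cost e)
    (fst \<sigma>, (snd \<sigma>)(exp_val w a \<sigma> := exp_val w e \<sigma>))"
| Seq: "exec w c1 \<sigma> \<tau>1 \<sigma>1 \<Longrightarrow> exec w c2 \<sigma>1 \<tau>2 \<sigma>2 \<Longrightarrow> exec w (Seq c1 c2) \<sigma> (\<tau>1 + \<tau>2) \<sigma>2"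
| IfTrue: "exp_val w e \<sigma> \<noteq> 0 \<Longrightarrow> exec w c1 \<sigma> \<tau> \<sigma>' \<Longrightarrow>
    exec w (If e c1 c2) \<sigma> (1 + exp_cost e + \<tau>) \<sigma>'"
| IfFalse: "exp_val w e \<sigma> = 0 \<Longrightarrow> exec w c2 \<sigma> \<tau> \<sigma>' \<Longrightarrow>
    exec w (If e c1 c2) \<sigma> (1 + exp_cost e + \<tau>) \<sigma>'"
| WhileFalse: "exp_val w e \<sigma> = 0 \<Longrightarrow> exec w (While e c) \<sigma> (1 + exp_cost e) \<sigma>"
| WhileTrue: "exp_val w e \<sigma> \<noteq> 0 \<Longrightarrow> exec w c \<sigma> \<tau>1 \<sigma>1 \<Longrightarrow> exec w (While e c) \<sigma>1 \<tau>2 \<sigma>2 \<Longrightarrow>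
    exec w (While e c) \<sigma> (1 + exp_cost e + \<tau>1 + \<tau>2) \<sigma>2"

inductive_cases exec_AssignE: "exec w (Assign i e) \<sigma> \<tau> \<sigma>'"
inductive_cases exec_StoreE: "exec w (Store a e) \<sigma> \<tau> \<sigma>'"
inductive_cases exec_SeqE: "exec w (Seq c1 c2) \<sigma> \<tau> \<sigma>'"
inductive_cases exec_IfE: "exec w (If e c1 c2) \<sigma> \<tau> \<sigma>'"
inductive_cases exec_WhileE: "exec w (While e c) \<sigma> \<tau> \<sigma>'"

text \<open>Hence an existential statement about a terminating run determines both its result and its
  running time.\<close>
lemma exec_deterministic:
  "exec w c \<sigma> \<tau> \<sigma>' \<Longrightarrow> exec w c \<sigma> \<tau>' \<sigma>'' \<Longrightarrow> \<tau>' = \<tau> \<and> \<sigma>'' = \<sigma>'"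
proof (induction arbitrary: \<tau>' \<sigma>'' rule: exec.induct)
  case Assign
  then show ?case by (rule exec_AssignE) simp
next
  case Store
  then show ?case by (rule exec_StoreE) simp
next
  case Seq
  from Seq.prems show ?case by (rule exec_SeqE) (metis Seq.IH)
next
  case IfTrue
  from IfTrue.prems show ?case by (rule exec_IfE) (use IfTrue.hyps(1) in \<open>auto dest!: IfTrue.IH\<close>)
next
  case IfFalse
  from IfFalse.prems show ?case by (rule exec_IfE) (use IfFalse.hyps(1) in \<open>auto dest!: IfFalse.IH\<close>)
next
  case WhileFalse
  from WhileFalse.prems show ?case by (rule exec_WhileE) (use WhileFalse.hyps(1) in auto)
next
  case WhileTrue
  from WhileTrue.prems show ?case by (rule exec_WhileE) (use WhileTrue.hyps(1) in simp_all, metis WhileTrue.IH)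
qed


section \<open>Approximate distance oracles\<close>

text \<open>The data structure \<open>D\<close> occupies the first \<open>length D\<close> memory cells; all other cells
  are zero-initialized working memory of the query algorithm. The query nodes are passed in
  registers 0 and 1, and the answer is returned in register 0.\<close>
definition init_state :: "nat list \<Rightarrow> nat \<Rightarrow> nat \<Rightarrow> state" where
  "init_state D s t = ((\<lambda>_. 0)(0 := s, 1 := t), (\<lambda>a. if a < length D then D ! a else 0))"

text \<open>The word list \<open>D\<close>, together with the query program \<open>P\<close>, is a \<open>(1 + \<epsilon>)\<close>-approximate distance
  oracle answering every query in time at most \<open>T\<close>. As hop distances are integers, rounding
  down a valid real-valued answer keeps it valid, so answers are single words.\<close>
definition approx_distance_oracle ::
  "nat \<Rightarrow> com \<Rightarrow> nat list \<Rightarrow> nat set \<Rightarrow> nat set set \<Rightarrow> real \<Rightarrow> real \<Rightarrow> bool" where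
  "approx_distance_oracle w P D V E \<epsilon> T \<longleftrightarrow>
     (\<forall>x\<in>set D. x < 2 ^ w) \<and>
     (\<forall>s\<in>V. \<forall>t\<in>V. \<exists>\<tau> \<sigma>. exec w P (init_state D s t) \<tau> \<sigma> \<and> real \<tau> \<le> T \<and>
        real (hop_dist E s t) \<le> real (fst \<sigma> 0) \<and>
        real (fst \<sigma> 0) \<le> (1 + \<epsilon>) * real (hop_dist E s t))"

text \<open>The bound \<open>(lg \<Delta>)\<^bsup>O(\<alpha>)\<^esup> \<cdot> (1/\<epsilon>)\<^bsup>O(\<alpha>\<^sup>2)\<^esup>\<close> with explicit constants. As usual in
  asymptotic bounds, the bases are read as being bounded away from 1; otherwise the bound would
  be 0 for \<open>\<Delta> = 1\<close> and tend to 0 for large \<open>\<epsilon>\<close>.\<close>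
definition query_time_bound :: "real \<Rightarrow> real \<Rightarrow> real \<Rightarrow> nat \<Rightarrow> real \<Rightarrow> real \<Rightarrow> real" where
  "query_time_bound C a b \<Delta> \<alpha> \<epsilon> =
     C * max 2 (log 2 (real \<Delta>)) powr (a * \<alpha>) * max 2 (1 / \<epsilon>) powr (b * \<alpha>\<^sup>2)"

text \<open>Words of \<open>O(lg n)\<close> bits.\<close>
definition word_size :: "nat \<Rightarrow> nat \<Rightarrow> nat" where
  "word_size c n = c * nat \<lceil>log 2 (real n + 1)\<rceil>"

end

theory Submission
  imports Defs
begin

text \<open>Let \<open>\<Delta>\<close> be the diameter and \<open>\<lambda>\<close> the doubling constant, \<open>2 ^ \<mu>\<close> about \<open>1/\<epsilon>\<close>, and
  \<open>r\<close> about \<open>lg \<Delta> * \<lambda> ^ \<mu>\<close>. Distances up to \<open>r * 2 ^ \<mu>\<close> are found by breadth-first search: the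
  searched ball has \<open>(r * 2 ^ \<mu>) ^ O(\<alpha>)\<close> vertices, of degree less than \<open>\<lambda>\<close>. For larger distances both
  endpoints can be moved to an \<open>r\<close>-net. Since balls of radius \<open>r/2\<close> in a connected unit-length graph of
  diameter at least \<open>r\<close> contain at least \<open>r/2\<close> vertices, the net has only \<open>O(n/r)\<close> points, so that each
  of them can afford a label of \<open>O(r)\<close> words. The label lists, for each scale \<open>2 ^ i * r\<close>, the
  points of a net at this scale within distance \<open>2 ^ i * r * 2 ^ \<mu>\<close>, of which there are at most
  \<open>\<lambda> ^ (\<mu> + 1)\<close>. At the lowest scale at which the net point next to the target is listed for the
  source, the detour through that point costs a relative error of at most \<open>\<epsilon>\<close>.\<close>

section \<open>Unit-length graphs of bounded doubling constant\<close>

text \<open>The space bound must not depend on \<epsilon> or \<lambda>. The construction balances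
  label size against net density by making both the same number:
  \<open>J = Suc l * lam ^ (\<mu> + 1)\<close> is the number of entries of a label and also the
  spacing of the net. At most \<open>2 * n / J\<close> net points with \<open>3 * J\<close> words
  each take O(n) words. This count needs a diameter of at least \<open>J\<close>; below that the
  search alone answers every query, and no labels are stored. The search radius is then
  \<open>Z = J * 2 ^ \<mu>\<close>. Since \<lambda> ^ \<mu> is (1/\<epsilon>) ^ O(\<alpha>) and a
  ball of radius \<open>Z\<close> has at most Z ^ O(\<alpha>) vertices up to constants, the exponent
  of 1/\<epsilon> becomes quadratic in \<alpha>. One program serves all graphs and all \<epsilon>,
  so its parameters have to be stored in words of O(lg n) bits, whereas \<open>Z\<close> is
  unbounded as \<epsilon> tends to 0. The stored radius is therefore \<open>min Z n\<close>.\<close>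

locale unit_graph =
  fixes V :: "'a set" and E :: "'a set set"
  assumes graph: "unit_length_graph V E" and connected: "connected_graph V E"
begin

section \<open>Metric properties of the hop distance\<close>

abbreviation "d \<equiv> hop_dist E"

lemma finite_V: "finite V" and V_nonempty: "V \<noteq> {}"
  using graph by (auto simp: unit_length_graph_def)

lemma adj_sym: "(u, v) \<in> adj E \<Longrightarrow> (v, u) \<in> adj E"
  by (simp add: adj_def insert_commute)

lemma adj_in_V: "(u, v) \<in> adj E \<Longrightarrow> u \<in> V \<and> v \<in> V"
  using graph by (auto simp: unit_length_graph_def adj_def)

lemma finite_E: "finite E"
  using graph by (auto simp: unit_length_graph_def intro!: finite_subset[of E "Pow V"])

lemma relpow_sym: "(u, v) \<in> adj E ^^ k \<Longrightarrow> (v, u) \<in> adj E ^^ k"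
proof (induction k arbitrary: v)
  case (Suc k)
  then obtain w where "(u, w) \<in> adj E ^^ k" "(w, v) \<in> adj E" by auto
  then show ?case using Suc.IH adj_sym by (blast intro: relpow_Suc_I2)
qed simp

lemma hop_dist_le: "(u, v) \<in> adj E ^^ k \<Longrightarrow> d u v \<le> k"
  unfolding hop_dist_def by (rule Least_le)

lemma hop_dist_relpow: "u \<in> V \<Longrightarrow> v \<in> V \<Longrightarrow> (u, v) \<in> adj E ^^ d u v"
  unfolding hop_dist_def using connected
  by (meson LeastI connected_graph_def rtrancl_imp_relpow)

lemma hop_dist_refl [simp]: "d u u = 0"
  using hop_dist_le[of u u 0] by simp

lemma hop_dist_eq_0: "u \<in> V \<Longrightarrow> v \<in> V \<Longrightarrow> d u v = 0 \<longleftrightarrow> u = v"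
  using hop_dist_relpow[of u v] by auto

lemma hop_dist_commute: "u \<in> V \<Longrightarrow> v \<in> V \<Longrightarrow> d u v = d v u"
  by (meson antisym hop_dist_le relpow_sym hop_dist_relpow)

lemma hop_dist_triangle: 
  assumes "u \<in> V" "v \<in> V" "w \<in> V"
  shows "d u w \<le> d u v + d v w"
  using hop_dist_le hop_dist_relpow[OF assms(1,2)] hop_dist_relpow[OF assms(2,3)]
  by (simp add: relpow_add relcomp.relcompI)

lemma hop_dist_adj: "(u, v) \<in> adj E \<Longrightarrow> d u v \<le> 1"
  using hop_dist_le[of u v 1] by simp

lemma hop_dist_Suc:
  assumes "u \<in> V" "v \<in> V" "d u v = Suc k"
  obtains w where "w \<in> V" "d u w = k" "(w, v) \<in> adj E"
proof -
  have "(u, v) \<in> adj E ^^ Suc k" using hop_dist_relpow[OF assms(1,2)] assms(3) by simp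
  then obtain w where w: "(u, w) \<in> adj E ^^ k" "(w, v) \<in> adj E" by auto
  have "w \<in> V" using w adj_in_V by blast
  moreover have "d u w = k"
    using hop_dist_le[OF w(1)] hop_dist_triangle[OF assms(1) \<open>w \<in> V\<close> assms(2)] hop_dist_adj[OF w(2)] assms(3)
    by linarith
  ultimately show ?thesis using w that by blast
qed

lemma hop_dist_intermediate:
  assumes "u \<in> V" "v \<in> V" "k \<le> d u v"
  obtains w where "w \<in> V" "d u w = k"
proof -
  have "\<exists>w\<in>V. d u w = k" if "v \<in> V" "d u v = k + l" for l v
    using that
  proof (induction l arbitrary: v)
    case (Suc l)
    then obtain w where "w \<in> V" "d u w = k + l" using hop_dist_Suc[of u v "k + l"] assms(1) by auto
    then show ?case using Suc.IH by blast
  qed auto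
  then show ?thesis using assms that by (metis le_Suc_ex)
qed

text \<open>Unit edge lengths enter here: along a shortest path every distance up to
  \<open>d u v\<close> occurs, so \<open>d u\<close> maps the ball onto
  \<open>{..k}\<close>.\<close>

lemma card_ball_ge:
  assumes "u \<in> V" "v \<in> V" "k \<le> d u v"
  shows "k + 1 \<le> card {w \<in> V. d u w \<le> k}"
proof -
  have "{..k} \<subseteq> d u ` {w \<in> V. d u w \<le> k}"
  proof
    fix i assume i: "i \<in> {..k}"
    then have "i \<le> d u v" using assms(3) by simp
    from hop_dist_intermediate[OF assms(1,2) this] obtain w where "w \<in> V" "d u w = i" .
    then show "i \<in> d u ` {w \<in> V. d u w \<le> k}" using i by (intro image_eqI[of _ _ w]) auto
  qed
  then have "card {..k} \<le> card {w \<in> V. d u w \<le> k}"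
    by - (rule surj_card_le[where f = "d u"], simp_all add: finite_V)
  then show ?thesis by simp
qed

lemma hop_dist_less_card:
  assumes "u \<in> V" "v \<in> V"
  shows "d u v < card V"
  using card_ball_ge[OF assms order_refl] card_mono[OF finite_V, of "{w \<in> V. d u w \<le> d u v}"] by auto

lemma finite_dists: "finite {d u v | u v. u \<in> V \<and> v \<in> V}"
  using finite_V by (simp add: finite_image_set2)

lemma hop_dist_le_diameter: "u \<in> V \<Longrightarrow> v \<in> V \<Longrightarrow> d u v \<le> diameter V E"
  unfolding diameter_def by (rule Max_ge[OF finite_dists]) auto

lemma diameter_attained:
  obtains u v where "u \<in> V" "v \<in> V" "d u v = diameter V E"
proof -
  have "diameter V E \<in> {d u v | u v. u \<in> V \<and> v \<in> V}"
    unfolding diameter_def using V_nonempty by (intro Max_in[OF finite_dists]) auto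
  then show ?thesis using that by auto
qed

text \<open>The two ends of a diametral pair cannot both be nearer to \<open>p\<close> than half the
  diameter. With \<open>card_ball_ge\<close>, every ball of radius at most half the diameter has
  more vertices than its radius.\<close>

lemma far_vertex:
  assumes "p \<in> V"
  obtains v where "v \<in> V" "diameter V E \<le> 2 * d p v"
proof -
  obtain u v where "u \<in> V" "v \<in> V" "d u v = diameter V E" by (rule diameter_attained)
  then have "diameter V E \<le> d p u + d p v"
    using hop_dist_triangle[of u p v] hop_dist_commute[of u p] assms by simp
  then show ?thesis using that \<open>u \<in> V\<close> \<open>v \<in> V\<close> by (cases "d p u \<le> d p v") auto
qed

lemma diameter_less_card: "diameter V E < card V"
  using hop_dist_less_card by (metis diameter_attained)

section \<open>Covering and packing bounds from the doubling constant\<close>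

abbreviation "lam \<equiv> doubling_constant V E"

text \<open>\<open>lam\<close> is a \<open>LEAST\<close>, so its covering property holds as soon as
  some number has it. \<open>card V\<close> does, with all vertices as centres, since each vertex
  lies in its own ball.\<close>

lemma doubling:
  assumes "v \<in> V" "r \<ge> 0"
  obtains S where "S \<subseteq> V" "card S \<le> lam"
    "hop_ball V E v (2 * r) \<subseteq> (\<Union>c\<in>S. hop_ball V E c r)"
proof -
  have "\<forall>v\<in>V. \<forall>r\<ge>0. \<exists>S\<subseteq>V. card S \<le> card V \<and> hop_ball V E v (2 * r) \<subseteq> (\<Union>c\<in>S. hop_ball V E c r)"
  proof (intro ballI allI impI exI[of _ V] conjI subset_refl order_refl subsetI)
    fix v x and r :: real
    assume "0 \<le> r" "x \<in> hop_ball V E v (2 * r)"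
    then show "x \<in> (\<Union>c\<in>V. hop_ball V E c r)" by (auto simp: hop_ball_def intro!: bexI[of _ x])
  qed
  then have "\<forall>v\<in>V. \<forall>r\<ge>0. \<exists>S\<subseteq>V. card S \<le> lam \<and> hop_ball V E v (2 * r) \<subseteq> (\<Union>c\<in>S. hop_ball V E c r)"
    unfolding doubling_constant_def by (rule LeastI)
  then show ?thesis using assms that by blast
qed

lemma iterated_doubling:
  assumes "v \<in> V" "r \<ge> 0"
  obtains S where "S \<subseteq> V" "card S \<le> lam ^ k"
    "hop_ball V E v (2 ^ k * r) \<subseteq> (\<Union>c\<in>S. hop_ball V E c r)"
proof -
  have "\<exists>S\<subseteq>V. card S \<le> lam ^ k \<and> hop_ball V E v (2 ^ k * r) \<subseteq> (\<Union>c\<in>S. hop_ball V E c r)"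
    using assms
  proof (induction k arbitrary: r)
    case 0
    then show ?case by (intro exI[of _ "{v}"]) auto
  next
    case (Suc k)
    have "0 \<le> 2 * r" using Suc.prems by simp
    from Suc.IH[OF assms(1) this] obtain S where S: "S \<subseteq> V" "card S \<le> lam ^ k"
        "hop_ball V E v (2 ^ k * (2 * r)) \<subseteq> (\<Union>c\<in>S. hop_ball V E c (2 * r))" by auto
    have "\<exists>S'\<subseteq>V. card S' \<le> lam \<and> hop_ball V E c (2 * r) \<subseteq> (\<Union>c\<in>S'. hop_ball V E c r)" if "c \<in> V" for c
      by (rule doubling[OF that Suc.prems(2)]) blast
    then have "\<forall>c\<in>V. \<exists>S'. S' \<subseteq> V \<and> card S' \<le> lam \<and> hop_ball V E c (2 * r) \<subseteq> (\<Union>c\<in>S'. hop_ball V E c r)" by blast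
    from bchoice[OF this] obtain f where f: "\<And>c. c \<in> V \<Longrightarrow> f c \<subseteq> V" "\<And>c. c \<in> V \<Longrightarrow> card (f c) \<le> lam"
        "\<And>c. c \<in> V \<Longrightarrow> hop_ball V E c (2 * r) \<subseteq> (\<Union>c\<in>f c. hop_ball V E c r)" by blast
    have "finite S" using S(1) finite_V finite_subset by blast
    have "card (\<Union>c\<in>S. f c) \<le> (\<Sum>c\<in>S. card (f c))" by (rule card_UN_le[OF \<open>finite S\<close>])
    also have "\<dots> \<le> card S * lam" using f(2) S(1) sum_bounded_above[of S "\<lambda>c. card (f c)" lam] by auto
    also have "\<dots> \<le> lam ^ Suc k" using S(2) by (simp add: mult.commute)
    finally have "card (\<Union>c\<in>S. f c) \<le> lam ^ Suc k" .
    moreover have "(\<Union>c\<in>S. f c) \<subseteq> V" using S(1) f(1) by blast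
    moreover have "hop_ball V E v (2 ^ Suc k * r) \<subseteq> (\<Union>c\<in>(\<Union>c\<in>S. f c). hop_ball V E c r)"
    proof
      fix x assume "x \<in> hop_ball V E v (2 ^ Suc k * r)"
      then have "x \<in> hop_ball V E v (2 ^ k * (2 * r))" by (simp add: mult_ac)
      then obtain c where "c \<in> S" "x \<in> hop_ball V E c (2 * r)" using S(3) by blast
      moreover have "c \<in> V" using S(1) \<open>c \<in> S\<close> by blast
      ultimately show "x \<in> (\<Union>c\<in>(\<Union>c\<in>S. f c). hop_ball V E c r)" using f(3)[of c] by blast
    qed
    ultimately show ?case by blast
  qed
  then show ?thesis using that by blast
qed

definition separated :: "nat \<Rightarrow> 'a set \<Rightarrow> bool" where
  "separated r N \<longleftrightarrow> N \<subseteq> V \<and> (\<forall>x\<in>N. \<forall>y\<in>N. x \<noteq> y \<longrightarrow> r < d x y)"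

text \<open>A ball of radius \<open>r / 2\<close> contains at most one point of an
  \<open>r\<close>-separated set, so the points inject into the centres of a covering by such balls.
  One doubling leads from \<open>r / 2\<close> to \<open>r\<close> and \<open>k\<close> more to
  \<open>r * 2 ^ k\<close>.\<close>

lemma separated_card_ball:
  assumes "separated r N" "p \<in> V"
  shows "card {x \<in> N. d p x \<le> r * 2 ^ k} \<le> lam ^ (k + 1)"
proof -
  obtain S where S: "S \<subseteq> V" "card S \<le> lam ^ (k + 1)"
    "hop_ball V E p (2 ^ (k + 1) * (real r / 2)) \<subseteq> (\<Union>c\<in>S. hop_ball V E c (real r / 2))"
    using iterated_doubling[OF assms(2), of "real r / 2" "k + 1"] by auto
  let ?X = "{x \<in> N. d p x \<le> r * 2 ^ k}"
  have "\<exists>c\<in>S. 2 * d c x \<le> r" if "x \<in> ?X" for x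
  proof -
    have "real (d p x) \<le> real (r * 2 ^ k)" using that by (simp only: of_nat_le_iff mem_Collect_eq)
    then have "x \<in> hop_ball V E p (2 ^ (k + 1) * (real r / 2))"
      using that assms(1) by (auto simp: hop_ball_def separated_def mult_ac)
    then obtain c where "c \<in> S" "x \<in> hop_ball V E c (real r / 2)" using S(3) by blast
    then show ?thesis by (intro bexI[of _ c]) (auto simp: hop_ball_def)
  qed
  then obtain f where f: "\<And>x. x \<in> ?X \<Longrightarrow> f x \<in> S" "\<And>x. x \<in> ?X \<Longrightarrow> 2 * d (f x) x \<le> r"
    using bchoice[of ?X "\<lambda>x c. c \<in> S \<and> 2 * d c x \<le> r"] by blast
  have "inj_on f ?X"
  proof (rule inj_onI, rule ccontr)
    fix x y assume xy: "x \<in> ?X" "y \<in> ?X" "f x = f y" "x \<noteq> y"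
    have V: "x \<in> V" "y \<in> V" "f x \<in> V" using xy f(1) S(1) assms(1) by (auto simp: separated_def)
    have "d x y \<le> d (f x) x + d (f x) y"
      using hop_dist_triangle[of x "f x" y] hop_dist_commute[of x "f x"] V by simp
    then have "d x y \<le> r" using f(2)[OF xy(1)] f(2)[OF xy(2)] xy(3) by simp
    then have "\<not> r < d x y" by simp
    then show False using xy assms(1) by (simp add: separated_def)
  qed
  then have "card ?X \<le> card S"
    using f(1) S(1) finite_V by (intro card_inj_on_le[of f]) (auto intro: finite_subset)
  then show ?thesis using S(2) by simp
qed

text \<open>Hop distances are integers, so a ball of radius \<open>1 / 2\<close> is a single vertex,
  and a covering by such balls counts vertices.\<close>

lemma card_ball_le:
  assumes "v \<in> V"
  shows "card {w \<in> V. d v w \<le> 2 ^ k} \<le> lam ^ (k + 1)"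
proof -
  obtain S where S: "S \<subseteq> V" "card S \<le> lam ^ (k + 1)"
    "hop_ball V E v (2 ^ (k + 1) * (1 / 2)) \<subseteq> (\<Union>c\<in>S. hop_ball V E c (1 / 2))"
    using iterated_doubling[OF assms, of "1 / 2" "k + 1"] by auto
  have "{w \<in> V. d v w \<le> 2 ^ k} \<subseteq> S"
  proof
    fix w assume w: "w \<in> {w \<in> V. d v w \<le> 2 ^ k}"
    then have "real (d v w) \<le> real (2 ^ k)" by (simp only: of_nat_le_iff mem_Collect_eq)
    then have "w \<in> hop_ball V E v (2 ^ (k + 1) * (1 / 2))" using w by (simp add: hop_ball_def)
    then obtain c where c: "c \<in> S" "w \<in> hop_ball V E c (1 / 2)" using S(3) by blast
    then have "d c w = 0" by (simp add: hop_ball_def)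
    then show "w \<in> S" using c S(1) hop_dist_eq_0 w by auto
  qed
  then show ?thesis using S(1,2) finite_V by (meson card_mono finite_subset le_trans)
qed

lemma doubling_constant_pos: "lam \<ge> 1"
proof -
  obtain v where v: "v \<in> V" using V_nonempty by blast
  have "{w \<in> V. d v w \<le> 2 ^ 0} \<noteq> {}" using v by auto
  then have "card {w \<in> V. d v w \<le> 2 ^ 0} > 0" using finite_V by (simp add: card_gt_0_iff)
  then show ?thesis using card_ball_le[OF v, of 0] by simp
qed

text \<open>\<open>v\<close> and its neighbours lie in the ball of radius 1, which is one doubling
  above single vertices. This bounds the time for scanning an adjacency list.\<close>

lemma card_neighbours_less:
  assumes "v \<in> V"
  shows "card {w. (v, w) \<in> adj E} + 1 \<le> lam"
proof -
  have "v \<notin> {w. (v, w) \<in> adj E}"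
    using graph by (auto simp: adj_def unit_length_graph_def)
  moreover have fin: "finite {w. (v, w) \<in> adj E}"
    using adj_in_V by (auto intro!: finite_subset[OF _ finite_V])
  ultimately have "card {w. (v, w) \<in> adj E} + 1 = card (insert v {w. (v, w) \<in> adj E})" by simp
  also have "\<dots> \<le> card {w \<in> V. d v w \<le> 2 ^ 0}"
    using assms adj_in_V hop_dist_adj finite_V by (intro card_mono) auto
  also have "\<dots> \<le> lam" using card_ball_le[OF assms, of 0] by simp
  finally show ?thesis .
qed

lemma neighbour_exists:
  assumes "v \<in> V" "card V \<ge> 2"
  obtains w where "(v, w) \<in> adj E"
proof -
  have "card (V - {v}) > 0" using assms finite_V by simp
  then obtain u where u: "u \<in> V" "u \<noteq> v" by (metis Diff_iff card_gt_0_iff ex_in_conv singletonI)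
  then have "d u v \<noteq> 0" using hop_dist_eq_0 assms by simp
  then obtain k where "d u v = Suc k" by (cases "d u v") auto
  then obtain w where "(w, v) \<in> adj E" using hop_dist_Suc[of u v k] u assms by metis
  then show ?thesis using adj_sym that by blast
qed

text \<open>It makes \<alpha> at least 1, so that constants and stray factors can be absorbed into
  the powers of the time bound.\<close>

lemma doubling_constant_ge_2:
  assumes "card V \<ge> 2"
  shows "lam \<ge> 2"
proof -
  obtain v where v: "v \<in> V" using V_nonempty by blast
  have "finite {w. (v, w) \<in> adj E}" using adj_in_V by (auto intro!: finite_subset[OF _ finite_V])
  moreover have "{w. (v, w) \<in> adj E} \<noteq> {}" using neighbour_exists[OF v assms] by blast
  ultimately have "card {w. (v, w) \<in> adj E} > 0" by (simp add: card_gt_0_iff)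
  then show ?thesis using card_neighbours_less[OF v] by simp
qed

section \<open>Counting edges\<close>

lemma card_adj_le: "card (adj E) \<le> 2 * card E"
proof -
  have "card {p. {fst p, snd p} = e} \<le> 2" if "e \<in> E" for e :: "'a set"
  proof -
    have "card e = 2" using graph that by (simp add: unit_length_graph_def)
    then obtain x y where e: "e = {x, y}" by (meson card_2_iff)
    then have "{p. {fst p, snd p} = e} \<subseteq> {(x, y), (y, x)}" by (auto simp: doubleton_eq_iff)
    then have "card {p. {fst p, snd p} = e} \<le> card {(x, y), (y, x)}" by (intro card_mono) auto
    also have "\<dots> \<le> 2" using card_length[of "[(x, y), (y, x)]"] by simp
    finally show ?thesis .
  qed
  then have "(\<Sum>e\<in>E. card {p. {fst p, snd p} = e}) \<le> 2 * card E"
    using sum_bounded_above[of E "\<lambda>e. card {p. {fst p, snd p} = e}" 2] by (simp add: mult.commute)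
  moreover have "adj E = (\<Union>e\<in>E. {p. {fst p, snd p} = e})" by (auto simp: adj_def)
  ultimately show ?thesis using card_UN_le[OF finite_E, of "\<lambda>e. {p. {fst p, snd p} = e}"] by simp
qed

lemma sum_degrees_le: "(\<Sum>v\<in>V. card {w. (v, w) \<in> adj E}) \<le> 2 * card E"
proof -
  have "finite {w. (v, w) \<in> adj E}" for v
    using adj_in_V by (auto intro!: finite_subset[OF _ finite_V])
  then have "(\<Sum>v\<in>V. card {w. (v, w) \<in> adj E}) = card (Sigma V (\<lambda>v. {w. (v, w) \<in> adj E}))"
    using finite_V by (simp add: card_SigmaI)
  also have "Sigma V (\<lambda>v. {w. (v, w) \<in> adj E}) = adj E" using adj_in_V by auto
  finally show ?thesis using card_adj_le by simp
qed

text \<open>Connectedness leaves no isolated vertex, so the sum of the degrees is at least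
  \<open>card V\<close>. This turns space O(n) into O(m).\<close>

lemma card_V_le:
  assumes "card V \<ge> 2"
  shows "card V \<le> 2 * card E"
proof -
  have "1 \<le> card {w. (v, w) \<in> adj E}" if "v \<in> V" for v
  proof -
    have "finite {w. (v, w) \<in> adj E}" using adj_in_V by (auto intro!: finite_subset[OF _ finite_V])
    moreover have "{w. (v, w) \<in> adj E} \<noteq> {}" using neighbour_exists[OF that assms] by blast
    ultimately show ?thesis by (simp add: Suc_le_eq card_gt_0_iff)
  qed
  then have "card V \<le> (\<Sum>v\<in>V. card {w. (v, w) \<in> adj E})"
    using sum_mono[of V "\<lambda>_. 1" "\<lambda>v. card {w. (v, w) \<in> adj E}"] by simp
  then show ?thesis using sum_degrees_le by simp
qed

text \<open>For the word size: the length of the data structure must be polynomial in the number of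
  vertices.\<close>

lemma card_E_le: "card E \<le> card V ^ 2"
proof -
  have "E \<subseteq> (\<lambda>(x, y). {x, y}) ` (V \<times> V)"
  proof
    fix e assume "e \<in> E"
    then have "e \<subseteq> V" "card e = 2" using graph by (auto simp: unit_length_graph_def)
    then obtain x y where "e = {x, y}" by (meson card_2_iff)
    then show "e \<in> (\<lambda>(x, y). {x, y}) ` (V \<times> V)" using \<open>e \<subseteq> V\<close> by auto
  qed
  then have "card E \<le> card (V \<times> V)" 
    by - (rule surj_card_le[where f = "\<lambda>(x, y). {x, y}"], simp_all add: finite_V)
  then show ?thesis by (simp add: power2_eq_square card_cartesian_product)
qed

section \<open>Nets and their size\<close>

lemma net_exists:
  obtains N where "separated r N" "\<And>v. v \<in> V \<Longrightarrow> \<exists>x\<in>N. d v x \<le> r"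
proof -
  have "finite {N. separated r N}"
    using finite_V by (auto simp: separated_def intro: finite_subset[of _ "Pow V"])
  moreover have "{} \<in> {N. separated r N}" by (simp add: separated_def)
  \<comment> \<open>A separated set that is maximal under inclusion is a net: a vertex farther than
    \<open>r\<close> from all its points could be added.\<close>
  ultimately obtain N where N: "separated r N" "\<And>N'. separated r N' \<Longrightarrow> N \<subseteq> N' \<Longrightarrow> N = N'"
    using finite_has_maximal2[of "{N. separated r N}" "{}"] by auto
  have "\<exists>x\<in>N. d v x \<le> r" if v: "v \<in> V" for v
  proof (rule ccontr)
    assume "\<not> ?thesis"
    then have far: "r < d v x" if "x \<in> N" for x using that by auto
    moreover have "r < d x v" if "x \<in> N" for x
      using far[OF that] hop_dist_commute[of v x] v that N(1) by (auto simp: separated_def)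
    ultimately have "separated r (insert v N)" using N(1) v by (auto simp: separated_def)
    then have "v \<in> N" using N(2) by blast
    then show False using far[of v] by simp
  qed
  then show ?thesis using that N(1) by blast
qed

text \<open>The balls of radius \<open>r div 2\<close> around the points of \<open>N\<close> are
  disjoint, and by the assumption on the diameter each has at least \<open>r div 2 + 1\<close>
  vertices. The factor 2 is the loss from halving; the \<open>+ 1\<close> makes up for the
  rounding.\<close>

lemma separated_card_le:
  assumes "separated r N" "r \<le> diameter V E"
  shows "card N * r \<le> 2 * card V"
proof -
  let ?B = "\<lambda>p. {w \<in> V. d p w \<le> r div 2}"
  have NV: "N \<subseteq> V" using assms(1) by (simp add: separated_def)
  have fin: "finite N" using NV finite_V finite_subset by blast
  have disj: "?B p \<inter> ?B q = {}" if "p \<in> N" "q \<in> N" "p \<noteq> q" for p q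
  proof -
    have "False" if "w \<in> V" "d p w \<le> r div 2" "d q w \<le> r div 2" for w
    proof -
      have "p \<in> V" "q \<in> V" using \<open>p \<in> N\<close> \<open>q \<in> N\<close> NV by auto
      then have "d p q \<le> d p w + d q w"
        using hop_dist_triangle[of p w q] hop_dist_commute[of q w] that by simp
      also have "\<dots> \<le> r" using that by linarith
      finally have "\<not> r < d p q" by simp
      then show False using assms(1) \<open>p \<in> N\<close> \<open>q \<in> N\<close> \<open>p \<noteq> q\<close> by (simp add: separated_def)
    qed
    then show ?thesis by blast
  qed
  have "r div 2 + 1 \<le> card (?B p)" if p: "p \<in> N" for p
  proof -
    have "p \<in> V" using p NV by blast
    then obtain v where "v \<in> V" "diameter V E \<le> 2 * d p v" by (rule far_vertex)
    then show ?thesis using card_ball_ge[of p v "r div 2"] \<open>p \<in> V\<close> assms(2) by auto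
  qed
  then have "card N * (r div 2 + 1) \<le> (\<Sum>p\<in>N. card (?B p))"
    using sum_bounded_below[of N "r div 2 + 1" "\<lambda>p. card (?B p)"] by simp
  also have "\<dots> = card (\<Union>p\<in>N. ?B p)"
    using fin finite_V disj by (intro card_UN_disjoint[symmetric]) auto
  also have "\<dots> \<le> card V" using finite_V by (intro card_mono) auto
  finally have *: "card N * (r div 2 + 1) \<le> card V" .
  have "card N * r \<le> card N * (2 * (r div 2 + 1))" by (intro mult_left_mono) auto
  then show ?thesis using * by (simp add: algebra_simps)
qed

text \<open>Shaped like the recursive clause of \<open>reach\<close>, so that
  \<open>reach_eq_ball\<close> follows by induction.\<close>

lemma ball_Suc:
  assumes "s \<in> V"
  shows "{v \<in> V. d s v \<le> Suc k} = {v \<in> V. d s v \<le> k} \<union> (\<Union>u\<in>{v \<in> V. d s v \<le> k}. {w. (u, w) \<in> adj E})"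
    (is "?L = ?R")
proof
  show "?L \<subseteq> ?R"
  proof
    fix v assume v: "v \<in> ?L"
    show "v \<in> ?R"
    proof (cases "d s v \<le> k")
      case False
      then have "d s v = Suc k" using v by simp
      then obtain w where "w \<in> V" "d s w = k" "(w, v) \<in> adj E" using hop_dist_Suc[of s v k] assms v by auto
      then show ?thesis by auto
    qed (use v in auto)
  qed
  show "?R \<subseteq> ?L"
  proof
    fix v assume v: "v \<in> ?R"
    show "v \<in> ?L"
    proof (cases "v \<in> V \<and> d s v \<le> k")
      case False
      then obtain u where "u \<in> V" "d s u \<le> k" "(u, v) \<in> adj E" using v by auto
      moreover have "v \<in> V" using calculation adj_in_V by blast
      ultimately show ?thesis using hop_dist_triangle[of s u v] hop_dist_adj[of u v] assms by auto
    qed auto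
  qed
qed

end

section \<open>The query program\<close>

definition runs :: "nat \<Rightarrow> com \<Rightarrow> state \<Rightarrow> nat \<Rightarrow> (state \<Rightarrow> bool) \<Rightarrow> bool" where
  "runs w c \<sigma> T Q \<longleftrightarrow> (\<exists>\<tau> \<sigma>'. exec w c \<sigma> \<tau> \<sigma>' \<and> \<tau> \<le> T \<and> Q \<sigma>')"

lemma runs_Assign:
  "1 + exp_cost e \<le> T \<Longrightarrow> Q ((fst \<sigma>)(i := exp_val w e \<sigma>), snd \<sigma>) \<Longrightarrow> runs w (Assign i e) \<sigma> T Q"
  unfolding runs_def using exec.Assign by blast

lemma runs_Store:
  "1 + exp_cost a + exp_cost e \<le> T \<Longrightarrow>
   Q (fst \<sigma>, (snd \<sigma>)(exp_val w a \<sigma> := exp_val w e \<sigma>)) \<Longrightarrow> runs w (Store a e) \<sigma> T Q"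
  unfolding runs_def using exec.Store by blast

text \<open>The run of \<open>c2\<close> stands inside the postcondition of \<open>c1\<close>.
  Proofs thus push a state through a program as with weakest preconditions, splitting the budget on
  the way.\<close>

lemma runs_Seq:
  assumes "runs w c1 \<sigma> T1 (\<lambda>\<sigma>'. runs w c2 \<sigma>' T2 Q)" "T1 + T2 \<le> T"
  shows "runs w (Seq c1 c2) \<sigma> T Q"
proof -
  obtain \<tau>1 \<sigma>1 \<tau>2 \<sigma>2 where "exec w c1 \<sigma> \<tau>1 \<sigma>1" "\<tau>1 \<le> T1" "exec w c2 \<sigma>1 \<tau>2 \<sigma>2" "\<tau>2 \<le> T2" "Q \<sigma>2"
    using assms(1) unfolding runs_def by blast
  then show ?thesis unfolding runs_def using assms(2) exec.Seq by (meson add_mono le_trans)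
qed

lemma runs_If:
  assumes "exp_val w e \<sigma> \<noteq> 0 \<Longrightarrow> runs w c1 \<sigma> T' Q" "exp_val w e \<sigma> = 0 \<Longrightarrow> runs w c2 \<sigma> T' Q"
    "1 + exp_cost e + T' \<le> T"
  shows "runs w (If e c1 c2) \<sigma> T Q"
proof (cases "exp_val w e \<sigma> = 0")
  case True
  then obtain \<tau> \<sigma>' where "exec w c2 \<sigma> \<tau> \<sigma>'" "\<tau> \<le> T'" "Q \<sigma>'" using assms(2) unfolding runs_def by blast
  then show ?thesis unfolding runs_def using exec.IfFalse[OF True] assms(3)
    by (meson add_left_mono le_trans)
next
  case False
  then obtain \<tau> \<sigma>' where "exec w c1 \<sigma> \<tau> \<sigma>'" "\<tau> \<le> T'" "Q \<sigma>'" using assms(1) unfolding runs_def by blast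
  then show ?thesis unfolding runs_def using exec.IfTrue[OF False] assms(3)
    by (meson add_left_mono le_trans)
qed

lemma runs_mono: "runs w c \<sigma> T Q \<Longrightarrow> T \<le> T' \<Longrightarrow> (\<And>\<sigma>. Q \<sigma> \<Longrightarrow> Q' \<sigma>) \<Longrightarrow> runs w c \<sigma> T' Q'"
  unfolding runs_def by (meson le_trans)

text \<open>The index \<open>k\<close> of the invariant doubles as the number of remaining
  iterations. At 0 the guard must fail, because 0 is not a \<open>Suc\<close>. The last
  \<open>1 + exp_cost e\<close> pays for the failing test.\<close>

lemma runs_While:
  assumes "I k \<sigma>"
    and step: "\<And>k \<sigma>. I k \<sigma> \<Longrightarrow> exp_val w e \<sigma> \<noteq> 0 \<Longrightarrow> \<exists>k'. k = Suc k' \<and> runs w c \<sigma> B (I k')"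
    and exit: "\<And>k \<sigma>. I k \<sigma> \<Longrightarrow> exp_val w e \<sigma> = 0 \<Longrightarrow> Q \<sigma>"
    and T: "k * (B + 1 + exp_cost e) + 1 + exp_cost e \<le> T"
  shows "runs w (While e c) \<sigma> T Q"
proof -
  have "runs w (While e c) \<sigma> (k * (B + 1 + exp_cost e) + 1 + exp_cost e) Q"
    using assms(1)
  proof (induction k arbitrary: \<sigma>)
    case 0
    then have e: "exp_val w e \<sigma> = 0" using step by blast
    show ?case unfolding runs_def
      using exec.WhileFalse[OF e, of c] exit[OF 0 e]
      by (intro exI[of _ "1 + exp_cost e"] exI[of _ \<sigma>]) simp
  next
    case (Suc k)
    show ?case
    proof (cases "exp_val w e \<sigma> = 0")
      case True
      show ?thesis unfolding runs_def
        using exec.WhileFalse[OF True, of c] exit[OF Suc.prems True]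
        by (intro exI[of _ "1 + exp_cost e"] exI[of _ \<sigma>]) simp
    next
      case False
      then have "runs w c \<sigma> B (I k)" using step[OF Suc.prems] by auto
      then obtain \<tau>1 \<sigma>1 where 1: "exec w c \<sigma> \<tau>1 \<sigma>1" "\<tau>1 \<le> B" "I k \<sigma>1" unfolding runs_def by blast
      obtain \<tau>2 \<sigma>2 where 2: "exec w (While e c) \<sigma>1 \<tau>2 \<sigma>2" "\<tau>2 \<le> k * (B + 1 + exp_cost e) + 1 + exp_cost e" "Q \<sigma>2"
        using Suc.IH[OF 1(3)] unfolding runs_def by blast
      have "1 + exp_cost e + \<tau>1 + \<tau>2 \<le> Suc k * (B + 1 + exp_cost e) + 1 + exp_cost e"
        using 1(2) 2(2) by (simp add: algebra_simps)
      then show ?thesis unfolding runs_def using exec.WhileTrue[OF False 1(1) 2(1)] 2(3) by blast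
    qed
  qed
  then show ?thesis using T runs_mono by blast
qed

abbreviation "add_exp a b \<equiv> Bin Add a b"

text \<open>Cell 0 holds the address of an array of marks indexed by vertices, cell 1 the address of the list
  of marked vertices, cell 2 the search radius. The record of vertex \<open>v\<close> starts at cell \<open>3 + 3 v\<close>
  and consists of the start and end addresses of its adjacency list and the address of the label
  of its net point.\<close>

definition "rec_addr v = add_exp (Const 3) (Bin Mul (Const 3) v)"
definition "mark_addr v = add_exp (Load (Const 0)) v"
definition "list_addr k = add_exp (Load (Const 1)) k"

text \<open>Registers: 0 and 1 hold the query, 2 the number of finished rounds, 3 the length of the
  list, 4 and 5 the current position and the end of a round in the list, 7 and 8 the same in an
  adjacency list. \<open>Assign 9 (Reg 9)\<close> serves as the empty branch.\<close>

definition "scan_edges = While (Bin Less (Reg 7) (Reg 8))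
  (Seq (Assign 9 (Load (Reg 7)))
  (Seq (If (Load (mark_addr (Reg 9))) (Assign 9 (Reg 9))
         (Seq (Store (mark_addr (Reg 9)) (Const 1))
         (Seq (Store (list_addr (Reg 3)) (Reg 9)) (Assign 3 (add_exp (Reg 3) (Const 1))))))
     (Assign 7 (add_exp (Reg 7) (Const 1)))))"

text \<open>A round rescans the whole list of marked vertices rather than just the last layer. The invariant is
  then simply that the list enumerates a ball, and the extra time is within the bound.\<close>

definition "bfs_round = While (Bin Less (Reg 4) (Reg 5))
  (Seq (Assign 6 (rec_addr (Load (list_addr (Reg 4)))))
  (Seq (Assign 7 (Load (Reg 6)))
  (Seq (Assign 8 (Load (add_exp (Reg 6) (Const 1))))
  (Seq scan_edges (Assign 4 (add_exp (Reg 4) (Const 1)))))))"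

text \<open>The target is tested before every round, so once it is marked, register 2 holds its
  exact distance. Comparisons yield 0 or 1, on which bitwise \<open>And\<close> is
  conjunction.\<close>

definition "bfs = 
  Seq (Store (mark_addr (Reg 0)) (Const 1))
  (Seq (Store (list_addr (Const 0)) (Reg 0))
  (Seq (Assign 2 (Const 0))
  (Seq (Assign 3 (Const 1))
  (While (Bin And (Bin Eq (Load (mark_addr (Reg 1))) (Const 0)) (Bin Less (Reg 2) (Load (Const 2))))
    (Seq (Assign 5 (Reg 3))
    (Seq (Assign 4 (Const 0))
    (Seq bfs_round (Assign 2 (add_exp (Reg 2) (Const 1))))))))))"

text \<open>An entry has three words. Register 2 walks through the label for the source and register
  3 through the one for the target; field 0 of the former is compared with field 1 of the latter.
  There is no end test, because this code is entered only when a match is certain.\<close>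

definition "label_search =
  Seq (Assign 2 (Load (add_exp (Const 2) (rec_addr (Reg 0)))))
  (Seq (Assign 3 (Load (add_exp (Const 2) (rec_addr (Reg 1)))))
  (Seq (While (Bin Eq (Bin Eq (Load (Reg 2)) (Load (add_exp (Reg 3) (Const 1)))) (Const 0))
     (Seq (Assign 2 (add_exp (Reg 2) (Const 3))) (Assign 3 (add_exp (Reg 3) (Const 3)))))
   (Assign 0 (Load (add_exp (Reg 2) (Const 2))))))"

text \<open>The test for equal nodes serves the graph with a single vertex: it has no edges, so the
  space bound forces an empty data structure, and the answer has to come without reading
  memory.\<close>

definition "query = If (Bin Eq (Reg 0) (Reg 1)) (Assign 0 (Const 0))
  (Seq bfs (If (Load (mark_addr (Reg 1))) (Assign 0 (Reg 2)) label_search))"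

section \<open>Correctness and running time of the program\<close>

lemmas addr_defs = rec_addr_def mark_addr_def list_addr_def

text \<open>The search in terms of adjacency sets alone. The program is verified against it without
  any metric; \<open>reach_eq_ball\<close> later identifies these sets with balls.\<close>

primrec reach :: "(nat \<Rightarrow> nat set) \<Rightarrow> nat \<Rightarrow> nat \<Rightarrow> nat set" where
  "reach f s 0 = {s}"
| "reach f s (Suc k) = reach f s k \<union> \<Union> (f ` reach f s k)"

lemma reach_mono: "k \<le> l \<Longrightarrow> reach f s k \<subseteq> reach f s l"
  by (induction l) (auto simp: le_Suc_eq)

text \<open>The contract between data structure and program. \<open>cells\<close> leaves room for
  two working arrays of \<open>n\<close> cells behind \<open>D\<close>, so that address arithmetic
  never wraps; \<open>R\<close> does the same for the round counter. Here \<open>lam\<close> is just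
  a bound on the lengths of adjacency lists.\<close>

locale oracle_layout =
  fixes w n R lam J :: nat and D :: "nat list" and adjs :: "nat \<Rightarrow> nat set"
  assumes len: "3 + 3 * n \<le> length D" and cells: "length D + 2 * n + 3 < 2 ^ w"
    and D_bound: "\<And>x. x \<in> set D \<Longrightarrow> x < 2 ^ w"
    and D0: "D ! 0 = length D" and D1: "D ! 1 = length D + n" and D2: "D ! 2 = R" and R: "R \<le> n"
    and edges: "\<And>v. v < n \<Longrightarrow> D ! (3 + 3 * v) \<le> D ! (4 + 3 * v) \<and> D ! (4 + 3 * v) \<le> length D \<and>
        D ! (4 + 3 * v) - D ! (3 + 3 * v) \<le> lam \<and>
        (!) D ` {D ! (3 + 3 * v)..<D ! (4 + 3 * v)} = adjs v"
    and adjs: "\<And>v. v < n \<Longrightarrow> adjs v \<subseteq> {..<n}"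
begin

text \<open>Distinctness keeps the list within its \<open>n\<close> cells and also makes its length
  the size of the enumerated ball, which is what the time bound counts.\<close>

definition memory :: "nat \<Rightarrow> nat \<Rightarrow> nat list \<Rightarrow> state \<Rightarrow> bool" where
  "memory s t xs \<sigma> \<longleftrightarrow> fst \<sigma> 0 = s \<and> fst \<sigma> 1 = t \<and> fst \<sigma> 3 = length xs \<and>
     (\<forall>a<length D. snd \<sigma> a = D ! a) \<and>
     (\<forall>v<n. snd \<sigma> (length D + v) = (if v \<in> set xs then 1 else 0)) \<and>
     (\<forall>i<length xs. snd \<sigma> (length D + n + i) = xs ! i) \<and>
     distinct xs \<and> set xs \<subseteq> {..<n}"

lemma memory_length: "memory s t xs \<sigma> \<Longrightarrow> length xs \<le> n"
  unfolding memory_def by (metis card_lessThan card_mono distinct_card finite_lessThan)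

lemma memory_cong:
  assumes "memory s t xs \<sigma>" "fst \<sigma>' 0 = fst \<sigma> 0" "fst \<sigma>' 1 = fst \<sigma> 1" "fst \<sigma>' 3 = fst \<sigma> 3" "snd \<sigma>' = snd \<sigma>"
  shows "memory s t xs \<sigma>'"
  using assms by (simp add: memory_def)

lemma memory_insert:
  assumes \<sigma>: "memory s t xs \<sigma>" and u: "u < n" "u \<notin> set xs"
    and \<sigma>': "fst \<sigma>' 0 = fst \<sigma> 0" "fst \<sigma>' 1 = fst \<sigma> 1" "fst \<sigma>' 3 = Suc (fst \<sigma> 3)"
      "snd \<sigma>' = (snd \<sigma>)(length D + u := 1, length D + n + length xs := u)"
  shows "memory s t (xs @ [u]) \<sigma>'"
proof -
  have "snd \<sigma>' a = D ! a" if "a < length D" for a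
    using \<sigma> that \<sigma>'(4) by (simp add: memory_def)
  moreover have "snd \<sigma>' (length D + v) = (if v \<in> set (xs @ [u]) then 1 else 0)" if "v < n" for v
    using \<sigma> that \<sigma>'(4) by (simp add: memory_def)
  moreover have "snd \<sigma>' (length D + n + i) = (xs @ [u]) ! i" if "i < length (xs @ [u])" for i
    using \<sigma> u(1) that \<sigma>'(4) by (cases "i = length xs") (simp_all add: memory_def nth_append)
  ultimately show ?thesis using \<sigma> u \<sigma>'(1-3) by (simp add: memory_def)
qed

text \<open>The list grows only at its end: the enclosing round walks through \<open>xs\<close>
  meanwhile and needs this prefix intact. An iteration is given 35 units for the body and 4 for the
  guard, rounded up to 40.\<close>

lemma scan_edges_runs:
  assumes "memory s t xs \<sigma>" "v < n" "fst \<sigma> 7 = D ! (3 + 3 * v)" "fst \<sigma> 8 = D ! (4 + 3 * v)"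
    and zs: "fst \<sigma> 4 = r4" "fst \<sigma> 5 = r5" "fst \<sigma> 2 = r2"
  shows "runs w scan_edges \<sigma> (lam * 40 + 4)
    (\<lambda>\<sigma>'. \<exists>ys. memory s t (xs @ ys) \<sigma>' \<and> set (xs @ ys) = set xs \<union> adjs v \<and>
       fst \<sigma>' 4 = r4 \<and> fst \<sigma>' 5 = r5 \<and> fst \<sigma>' 2 = r2)"
proof -
  define b e where "b = D ! (3 + 3 * v)" and "e = D ! (4 + 3 * v)"
  have be: "b \<le> e" "e \<le> length D" "e - b \<le> lam" "(!) D ` {b..<e} = adjs v"
    using edges[OF assms(2)] by (auto simp: b_def e_def)
  define I where "I = (\<lambda>k \<sigma>'. \<exists>ys. memory s t (xs @ ys) \<sigma>' \<and>
     (\<exists>j. fst \<sigma>' 7 = j \<and> b \<le> j \<and> j \<le> e \<and> k = e - j \<and> set (xs @ ys) = set xs \<union> (!) D ` {b..<j}) \<and>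
     fst \<sigma>' 8 = e \<and> fst \<sigma>' 4 = r4 \<and> fst \<sigma>' 5 = r5 \<and> fst \<sigma>' 2 = r2)"
  have w0: "w > 0" using cells by (cases w) auto
  have one: "1 mod 2 ^ w = (1::nat)" using w0 by simp
  show ?thesis unfolding scan_edges_def
  proof (rule runs_While[where I = I and k = "e - b" and B = 35])
    show "I (e - b) \<sigma>" unfolding I_def
      using assms be(1) by (intro exI[of _ "[]"]) (auto simp: b_def e_def)
    show "(e - b) * (35 + 1 + exp_cost (Bin Less (Reg 7) (Reg 8))) + 1 + exp_cost (Bin Less (Reg 7) (Reg 8)) \<le> lam * 40 + 4"
      using be(3) by simp
    fix k \<sigma>
    assume "I k \<sigma>"
    then obtain ys j where I: "memory s t (xs @ ys) \<sigma>" "fst \<sigma> 7 = j" "b \<le> j" "j \<le> e" "k = e - j"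
      "set (xs @ ys) = set xs \<union> (!) D ` {b..<j}" "fst \<sigma> 8 = e" "fst \<sigma> 4 = r4" "fst \<sigma> 5 = r5" "fst \<sigma> 2 = r2"
      unfolding I_def by blast
    {
      assume "exp_val w (Bin Less (Reg 7) (Reg 8)) \<sigma> = 0"
      then have "j = e" using I one by (simp split: if_splits)
      then show "\<exists>ys. memory s t (xs @ ys) \<sigma> \<and> set (xs @ ys) = set xs \<union> adjs v \<and>
         fst \<sigma> 4 = r4 \<and> fst \<sigma> 5 = r5 \<and> fst \<sigma> 2 = r2"
        using I be(4) by blast
    }
    assume "exp_val w (Bin Less (Reg 7) (Reg 8)) \<sigma> \<noteq> 0"
    then have j: "j < e" using I by (simp split: if_splits)
    define u where "u = D ! j"
    have "u \<in> adjs v" using be(4) I j by (auto simp: u_def)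
    then have u: "u < n" using adjs assms(2) by blast
    have pos: "0 < length D" "Suc 0 < length D" using len u by auto
    have mem: "snd \<sigma> j = u" "snd \<sigma> 0 = length D" "snd \<sigma> (Suc 0) = length D + n" "fst \<sigma> 3 = length (xs @ ys)"
        "snd \<sigma> (length D + u) = (if u \<in> set (xs @ ys) then 1 else 0)"
      using I(1) j be(2) D0 D1 pos u unfolding memory_def by (auto simp: u_def)
    have lenle: "length (xs @ ys) \<le> n" by (rule memory_length[OF I(1)])
    have small: "(length D + u) mod 2 ^ w = length D + u"
        "(length D + n + length (xs @ ys)) mod 2 ^ w = length D + n + length (xs @ ys)"
        "(length (xs @ ys) + 1) mod 2 ^ w = length (xs @ ys) + 1" "(j + 1) mod 2 ^ w = j + 1"
      using cells u lenle j be(2) by (auto intro!: mod_less)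
    have range: "{b..<Suc j} = insert j {b..<j}" using I(3) by auto
    show "\<exists>k'. k = Suc k' \<and> runs w
       (Seq (Assign 9 (Load (Reg 7)))
        (Seq (If (Load (mark_addr (Reg 9))) (Assign 9 (Reg 9))
               (Seq (Store (mark_addr (Reg 9)) (Const 1))
               (Seq (Store (list_addr (Reg 3)) (Reg 9)) (Assign 3 (add_exp (Reg 3) (Const 1))))))
           (Assign 7 (add_exp (Reg 7) (Const 1))))) \<sigma> 35 (I k')"
    proof (intro exI conjI)
      show "k = Suc (e - Suc j)" using I(5) j by simp
      show "runs w
       (Seq (Assign 9 (Load (Reg 7)))
        (Seq (If (Load (mark_addr (Reg 9))) (Assign 9 (Reg 9))
               (Seq (Store (mark_addr (Reg 9)) (Const 1))
               (Seq (Store (list_addr (Reg 3)) (Reg 9)) (Assign 3 (add_exp (Reg 3) (Const 1))))))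
           (Assign 7 (add_exp (Reg 7) (Const 1))))) \<sigma> 35 (I (e - Suc j))"
      proof (rule runs_Seq[where ?T1.0 = 3 and ?T2.0 = 32], rule runs_Assign)
        let ?\<sigma> = "((fst \<sigma>)(9 := exp_val w (Load (Reg 7)) \<sigma>), snd \<sigma>)"
        have \<sigma>9: "fst ?\<sigma> 9 = u" using mem I(2) by simp
        have addr: "exp_val w (mark_addr (Reg 9)) ?\<sigma> = length D + u"
          using mem small \<sigma>9 by (simp add: addr_defs)
        have guard: "exp_val w (Load (mark_addr (Reg 9))) ?\<sigma> = (if u \<in> set (xs @ ys) then 1 else 0)"
          using mem(5) addr by simp
        have set_eq: "set (xs @ ys) \<union> {u} = set xs \<union> (!) D ` {b..<Suc j}"
          using I(6) by (simp add: range u_def)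
        show "runs w (Seq (If (Load (mark_addr (Reg 9))) (Assign 9 (Reg 9))
               (Seq (Store (mark_addr (Reg 9)) (Const 1))
               (Seq (Store (list_addr (Reg 3)) (Reg 9)) (Assign 3 (add_exp (Reg 3) (Const 1))))))
           (Assign 7 (add_exp (Reg 7) (Const 1)))) ?\<sigma> 32 (I (e - Suc j))"
        proof (rule runs_Seq[where ?T1.0 = 27 and ?T2.0 = 5], rule runs_If[where T' = 20])
          assume "exp_val w (Load (mark_addr (Reg 9))) ?\<sigma> \<noteq> 0"
          then have u_old: "u \<in> set (xs @ ys)" using guard by (simp split: if_splits)
          let ?\<sigma>' = "((fst ?\<sigma>)(9 := u), snd ?\<sigma>)"
          have "memory s t (xs @ ys) ((fst ?\<sigma>')(7 := Suc j), snd ?\<sigma>')" by (rule memory_cong[OF I(1)]) simp_all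
          then have "I (e - Suc j) ((fst ?\<sigma>')(7 := Suc j), snd ?\<sigma>')"
            unfolding I_def using u_old set_eq j I(3,7-10)
            by (intro exI[of _ ys]) (simp add: insert_absorb)
          then have "runs w (Assign 7 (add_exp (Reg 7) (Const 1))) ?\<sigma>' 5 (I (e - Suc j))"
            using I(2) small(4) one by (intro runs_Assign) simp_all
          then show "runs w (Assign 9 (Reg 9)) ?\<sigma> 20
              (\<lambda>\<sigma>'. runs w (Assign 7 (add_exp (Reg 7) (Const 1))) \<sigma>' 5 (I (e - Suc j)))"
            using \<sigma>9 by - (rule runs_Assign, simp_all)
        next
          assume "exp_val w (Load (mark_addr (Reg 9))) ?\<sigma> = 0"
          then have u_new: "u \<notin> set (xs @ ys)" using guard by (simp split: if_splits)
          let ?m = "(snd \<sigma>)(length D + u := 1, length D + n + length (xs @ ys) := u)"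
          let ?\<sigma>1 = "(fst ?\<sigma>, (snd ?\<sigma>)(length D + u := 1))"
          let ?\<sigma>3 = "((fst ?\<sigma>)(3 := Suc (length (xs @ ys))), ?m)"
          have addr': "exp_val w (list_addr (Reg 3)) ?\<sigma>1 = length D + n + length (xs @ ys)"
            using mem small pos one by (simp add: addr_defs)
          have "memory s t ((xs @ ys) @ [u]) ((fst ?\<sigma>3)(7 := Suc j), snd ?\<sigma>3)"
            by (rule memory_insert[OF I(1) u u_new]) (simp_all add: mem)
          then have "I (e - Suc j) ((fst ?\<sigma>3)(7 := Suc j), snd ?\<sigma>3)"
            unfolding I_def using set_eq j I(3,7-10)
            by (intro exI[of _ "ys @ [u]"]) simp
          then have last: "runs w (Assign 7 (add_exp (Reg 7) (Const 1))) ?\<sigma>3 5 (I (e - Suc j))"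
            using I(2) small(4) one by (intro runs_Assign) simp_all
          show "runs w (Seq (Store (mark_addr (Reg 9)) (Const 1))
               (Seq (Store (list_addr (Reg 3)) (Reg 9)) (Assign 3 (add_exp (Reg 3) (Const 1))))) ?\<sigma> 20
              (\<lambda>\<sigma>'. runs w (Assign 7 (add_exp (Reg 7) (Const 1))) \<sigma>' 5 (I (e - Suc j)))"
          proof (rule runs_Seq[where ?T1.0 = 7 and ?T2.0 = 13], rule runs_Store)
            have "runs w (Assign 3 (add_exp (Reg 3) (Const 1))) (fst ?\<sigma>, ?m) 6
              (\<lambda>\<sigma>'. runs w (Assign 7 (add_exp (Reg 7) (Const 1))) \<sigma>' 5 (I (e - Suc j)))"
              using last mem small(3) one by - (rule runs_Assign, simp_all)
            then have "runs w (Seq (Store (list_addr (Reg 3)) (Reg 9)) (Assign 3 (add_exp (Reg 3) (Const 1)))) ?\<sigma>1 13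
              (\<lambda>\<sigma>'. runs w (Assign 7 (add_exp (Reg 7) (Const 1))) \<sigma>' 5 (I (e - Suc j)))"
              using addr' \<sigma>9 by - (rule runs_Seq[where ?T1.0 = 7 and ?T2.0 = 6], rule runs_Store, simp_all add: list_addr_def)
            then show "runs w (Seq (Store (list_addr (Reg 3)) (Reg 9)) (Assign 3 (add_exp (Reg 3) (Const 1))))
              (fst ?\<sigma>, (snd ?\<sigma>)(exp_val w (mark_addr (Reg 9)) ?\<sigma> := exp_val w (Const 1) ?\<sigma>)) 13
              (\<lambda>\<sigma>'. runs w (Assign 7 (add_exp (Reg 7) (Const 1))) \<sigma>' 5 (I (e - Suc j)))"
              using addr one by simp
          qed (simp_all add: addr_defs)
        qed (simp_all add: addr_defs)
      qed simp_all
    qed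
  qed
qed

text \<open>Register 5 freezes the length of the list at the start of the round. Vertices appended
  meanwhile are not scanned, so the ball advances by exactly one step.\<close>

lemma bfs_round_runs:
  assumes "memory s t xs \<sigma>" "fst \<sigma> 4 = 0" "fst \<sigma> 5 = length xs" "fst \<sigma> 2 = r2" "length xs \<le> N"
  shows "runs w bfs_round \<sigma> (N * (lam * 40 + 40) + 4)
    (\<lambda>\<sigma>'. \<exists>ys. memory s t (xs @ ys) \<sigma>' \<and> set (xs @ ys) = set xs \<union> \<Union> (adjs ` set xs) \<and> fst \<sigma>' 2 = r2)"
proof -
  define I where "I = (\<lambda>k \<sigma>'. \<exists>ys. memory s t (xs @ ys) \<sigma>' \<and>
     (\<exists>i. fst \<sigma>' 4 = i \<and> i \<le> length xs \<and> k = length xs - i \<and>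
        set (xs @ ys) = set xs \<union> \<Union> (adjs ` set (take i xs))) \<and>
     fst \<sigma>' 5 = length xs \<and> fst \<sigma>' 2 = r2)"
  have "w > 0" using cells by (cases w) auto
  then have one: "1 mod 2 ^ w = (1::nat)" by simp
  let ?body = "Seq (Assign 6 (rec_addr (Load (list_addr (Reg 4)))))
    (Seq (Assign 7 (Load (Reg 6)))
    (Seq (Assign 8 (Load (add_exp (Reg 6) (Const 1))))
    (Seq scan_edges (Assign 4 (add_exp (Reg 4) (Const 1))))))"
  show ?thesis unfolding bfs_round_def
  proof (rule runs_While[where I = I and k = "length xs" and B = "lam * 40 + 35"])
    show "I (length xs) \<sigma>" unfolding I_def using assms by (intro exI[of _ "[]"]) auto
    have "length xs * (lam * 40 + 35 + 1 + 3) \<le> N * (lam * 40 + 40)"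
      using assms(5) by (intro mult_mono) auto
    then show "length xs * (lam * 40 + 35 + 1 + exp_cost (Bin Less (Reg 4) (Reg 5))) + 1 +
        exp_cost (Bin Less (Reg 4) (Reg 5)) \<le> N * (lam * 40 + 40) + 4"
      by simp
    fix k \<sigma>
    assume "I k \<sigma>"
    then obtain ys i where I: "memory s t (xs @ ys) \<sigma>" "fst \<sigma> 4 = i" "i \<le> length xs" "k = length xs - i"
      "set (xs @ ys) = set xs \<union> \<Union> (adjs ` set (take i xs))" "fst \<sigma> 5 = length xs" "fst \<sigma> 2 = r2"
      unfolding I_def by blast
    {
      assume "exp_val w (Bin Less (Reg 4) (Reg 5)) \<sigma> = 0"
      then have "i = length xs" using I one by (simp split: if_splits)
      then show "\<exists>ys. memory s t (xs @ ys) \<sigma> \<and> set (xs @ ys) = set xs \<union> \<Union> (adjs ` set xs) \<and> fst \<sigma> 2 = r2"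
        using I by auto
    }
    assume "exp_val w (Bin Less (Reg 4) (Reg 5)) \<sigma> \<noteq> 0"
    then have i: "i < length xs" using I by (simp split: if_splits)
    define v where "v = xs ! i"
    have "v \<in> set (xs @ ys)" using i by (simp add: v_def)
    moreover have "set (xs @ ys) \<subseteq> {..<n}" using I(1) by (simp add: memory_def)
    ultimately have v: "v < n" by blast
    have len_le: "length (xs @ ys) \<le> n" by (rule memory_length[OF I(1)])
    have pos: "0 < length D" "Suc 0 < length D" using len v by auto
    have mem: "snd \<sigma> 0 = length D" "snd \<sigma> (Suc 0) = length D + n" "snd \<sigma> (length D + n + i) = v"
      "snd \<sigma> (3 + 3 * v) = D ! (3 + 3 * v)" "snd \<sigma> (4 + 3 * v) = D ! (4 + 3 * v)"
      using I(1) i D0 D1 pos len v unfolding memory_def by (auto simp: v_def nth_append)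
    have small: "(length D + n + i) mod 2 ^ w = length D + n + i" "3 mod 2 ^ w = (3::nat)" "(3 * v) mod 2 ^ w = 3 * v"
      "(3 + 3 * v) mod 2 ^ w = 3 + 3 * v" "(Suc (3 + 3 * v)) mod 2 ^ w = 4 + 3 * v" "Suc i mod 2 ^ w = Suc i"
      using cells len len_le i v by (auto intro!: mod_less)
    show "\<exists>k'. k = Suc k' \<and> runs w ?body \<sigma> (lam * 40 + 35) (I k')"
    proof (intro exI conjI)
      show "k = Suc (length xs - Suc i)" using I(4) i by simp
      let ?\<sigma> = "((fst \<sigma>)(6 := 3 + 3 * v, 7 := D ! (3 + 3 * v), 8 := D ! (4 + 3 * v)), snd \<sigma>)"
      have "memory s t (xs @ ys) ?\<sigma>" using I(1) by (simp add: memory_def)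
      from scan_edges_runs[OF this v, of i "length xs" r2]
      have scan: "runs w scan_edges ?\<sigma> (lam * 40 + 4) (\<lambda>\<sigma>'. \<exists>zs. memory s t ((xs @ ys) @ zs) \<sigma>' \<and>
          set ((xs @ ys) @ zs) = set (xs @ ys) \<union> adjs v \<and>
          fst \<sigma>' 4 = i \<and> fst \<sigma>' 5 = length xs \<and> fst \<sigma>' 2 = r2)"
        using I by simp
      have last: "runs w (Assign 4 (add_exp (Reg 4) (Const 1))) \<sigma>' 5 (I (length xs - Suc i))"
        if zs: "\<exists>zs. memory s t ((xs @ ys) @ zs) \<sigma>' \<and> set ((xs @ ys) @ zs) = set (xs @ ys) \<union> adjs v \<and>
          fst \<sigma>' 4 = i \<and> fst \<sigma>' 5 = length xs \<and> fst \<sigma>' 2 = r2" for \<sigma>'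
      proof -
        obtain zs where zs: "memory s t ((xs @ ys) @ zs) \<sigma>'" "set ((xs @ ys) @ zs) = set (xs @ ys) \<union> adjs v"
          "fst \<sigma>' 4 = i" "fst \<sigma>' 5 = length xs" "fst \<sigma>' 2 = r2" using zs by blast
        have *: "exp_val w (add_exp (Reg 4) (Const 1)) \<sigma>' = Suc i" using zs(3) small one by simp
        have "set (xs @ ys @ zs) = set xs \<union> \<Union> (adjs ` set (take (Suc i) xs))"
          using zs(2) I(5) i by (simp add: take_Suc_conv_app_nth v_def) blast
        moreover have "memory s t (xs @ ys @ zs) ((fst \<sigma>')(4 := Suc i), snd \<sigma>')"
          by (rule memory_cong[OF zs(1)[unfolded append_assoc]]) simp_all
        ultimately have "I (length xs - Suc i) ((fst \<sigma>')(4 := Suc i), snd \<sigma>')"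
          using zs(4,5) i unfolding I_def by (intro exI[of _ "ys @ zs"]) (simp del: set_append)
        then show ?thesis by (intro runs_Assign) (simp, unfold *)
      qed
      show "runs w ?body \<sigma> (lam * 40 + 35) (I (length xs - Suc i))"
        apply (rule runs_Seq[where ?T1.0 = 10 and ?T2.0 = "lam * 40 + 25"])
         apply (rule runs_Assign)
          apply (simp add: addr_defs)
         apply (rule runs_Seq[where ?T1.0 = 3 and ?T2.0 = "lam * 40 + 22"])
          apply (rule runs_Assign)
           apply simp
          apply (rule runs_Seq[where ?T1.0 = 5 and ?T2.0 = "lam * 40 + 17"])
           apply (rule runs_Assign)
            apply simp
           apply (rule runs_Seq[where ?T1.0 = "lam * 40 + 4" and ?T2.0 = 5])
        subgoal
          using runs_mono[OF scan order_refl last] mem small I(2) one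
          by (simp add: addr_defs)
            apply simp_all
        done
    qed
  qed
qed

definition initial :: "nat \<Rightarrow> nat \<Rightarrow> state \<Rightarrow> bool" where
  "initial s t \<sigma> \<longleftrightarrow> fst \<sigma> 0 = s \<and> fst \<sigma> 1 = t \<and>
     (\<forall>a. snd \<sigma> a = (if a < length D then D ! a else 0))"

text \<open>In every round the list enumerates some \<open>reach adjs s k\<close> with
  \<open>k \<le> R\<close>, so \<open>N\<close> bounds its length throughout. The last clause makes
  \<open>k\<close> least, hence equal to the distance if \<open>t\<close> was reached.\<close>

lemma bfs_runs:
  assumes "initial s t \<sigma>" "s < n" "t < n" "card (reach adjs s R) \<le> N"
  shows "runs w bfs \<sigma> (R * (N * (lam * 40 + 40) + 40) + 60)
    (\<lambda>\<sigma>'. \<exists>xs k. memory s t xs \<sigma>' \<and> fst \<sigma>' 2 = k \<and> set xs = reach adjs s k \<and> k \<le> R \<and>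
       (t \<in> reach adjs s k \<or> k = R) \<and> (\<forall>k'<k. t \<notin> reach adjs s k'))"
proof -
  define I where "I = (\<lambda>m \<sigma>'. \<exists>xs k. memory s t xs \<sigma>' \<and> fst \<sigma>' 2 = k \<and> set xs = reach adjs s k \<and> k \<le> R \<and>
     m = R - k \<and> (\<forall>k'<k. t \<notin> reach adjs s k'))"
  have "w > 0" using cells by (cases w) auto
  then have one: "1 mod 2 ^ w = (1::nat)" by simp
  let ?body = "Seq (Assign 5 (Reg 3))
    (Seq (Assign 4 (Const 0))
    (Seq bfs_round (Assign 2 (add_exp (Reg 2) (Const 1)))))"
  let ?guard = "Bin And (Bin Eq (Load (mark_addr (Reg 1))) (Const 0)) (Bin Less (Reg 2) (Load (Const 2)))"
  have pos: "0 < length D" "Suc 0 < length D" "2 < length D" using len by auto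
  have loop: "runs w (While ?guard ?body) \<sigma> (R * (N * (lam * 40 + 40) + 40) + 20)
      (\<lambda>\<sigma>'. \<exists>xs k. memory s t xs \<sigma>' \<and> fst \<sigma>' 2 = k \<and> set xs = reach adjs s k \<and> k \<le> R \<and>
       (t \<in> reach adjs s k \<or> k = R) \<and> (\<forall>k'<k. t \<notin> reach adjs s k'))"
    if "memory s t [s] \<sigma>" "fst \<sigma> 2 = 0" for \<sigma>
  proof (rule runs_While[where I = I and k = R and B = "N * (lam * 40 + 40) + 20"])
    show "I R \<sigma>" unfolding I_def using that by (intro exI[of _ "[s]"]) auto
    show "R * (N * (lam * 40 + 40) + 20 + 1 + exp_cost ?guard) + 1 + exp_cost ?guard
        \<le> R * (N * (lam * 40 + 40) + 40) + 20"
      by (simp add: addr_defs algebra_simps)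
    fix m \<sigma>
    assume "I m \<sigma>"
    then obtain xs k where I: "memory s t xs \<sigma>" "fst \<sigma> 2 = k" "set xs = reach adjs s k" "k \<le> R"
      "m = R - k" "\<forall>k'<k. t \<notin> reach adjs s k'" unfolding I_def by blast
    have mem: "snd \<sigma> 0 = length D" "snd \<sigma> 2 = R" "snd \<sigma> (length D + t) = (if t \<in> set xs then 1 else 0)"
      "fst \<sigma> (Suc 0) = t" "fst \<sigma> 3 = length xs"
      using I(1) D0 D2 pos assms(3) unfolding memory_def by auto
    have two: "2 mod 2 ^ w = (2::nat)" using cells by (auto intro!: mod_less)
    have "(length D + t) mod 2 ^ w = length D + t"
      using cells assms(3) by (auto intro!: mod_less)
    then have guard: "exp_val w ?guard \<sigma> = (if t \<notin> set xs \<and> k < R then 1 else 0)"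
      using I(2) mem one two by (simp add: addr_defs)
    {
      assume "exp_val w ?guard \<sigma> = 0"
      then have "t \<in> set xs \<or> k = R" using guard I(4) by (auto split: if_splits)
      then show "\<exists>xs k. memory s t xs \<sigma> \<and> fst \<sigma> 2 = k \<and> set xs = reach adjs s k \<and> k \<le> R \<and>
         (t \<in> reach adjs s k \<or> k = R) \<and> (\<forall>k'<k. t \<notin> reach adjs s k')"
        using I by blast
    }
    assume "exp_val w ?guard \<sigma> \<noteq> 0"
    then have g: "t \<notin> reach adjs s k" "k < R" using guard I(3) by (auto split: if_splits)
    have Sk: "Suc k mod 2 ^ w = Suc k" using g(2) R cells by (auto intro!: mod_less)
    have fin: "finite (reach adjs s R)"
    proof -
      have "reach adjs s l \<subseteq> {..<n}" for l
        using assms(2) adjs by (induction l) auto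
      then show ?thesis using finite_subset by blast
    qed
    have "length xs = card (reach adjs s k)"
      using I(1,3) unfolding memory_def by (metis distinct_card)
    also have "\<dots> \<le> N"
      using card_mono[OF fin reach_mono[of k R]] g(2) assms(4) by simp
    finally have N: "length xs \<le> N" .
    let ?\<sigma> = "((fst \<sigma>)(5 := length xs, 4 := 0), snd \<sigma>)"
    have "memory s t xs ?\<sigma>" using I(1) by (simp add: memory_def)
    from bfs_round_runs[OF this _ _ _ N, of k]
    have round: "runs w bfs_round ?\<sigma> (N * (lam * 40 + 40) + 4) (\<lambda>\<sigma>'. \<exists>ys. memory s t (xs @ ys) \<sigma>' \<and>
        set (xs @ ys) = set xs \<union> \<Union> (adjs ` set xs) \<and> fst \<sigma>' 2 = k)"
      using I(2) by simp
    have last: "runs w (Assign 2 (add_exp (Reg 2) (Const 1))) \<sigma>' 5 (I (R - Suc k))"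
      if round_done: "\<exists>ys. memory s t (xs @ ys) \<sigma>' \<and> set (xs @ ys) = set xs \<union> \<Union> (adjs ` set xs) \<and> fst \<sigma>' 2 = k" for \<sigma>'
    proof -
      obtain ys where ys: "memory s t (xs @ ys) \<sigma>'" "set (xs @ ys) = set xs \<union> \<Union> (adjs ` set xs)" "fst \<sigma>' 2 = k"
        using round_done by blast
      have *: "exp_val w (add_exp (Reg 2) (Const 1)) \<sigma>' = Suc k" using ys(3) Sk one by simp
      have "set (xs @ ys) = reach adjs s (Suc k)" using ys(2) I(3) by simp
      moreover have "memory s t (xs @ ys) ((fst \<sigma>')(2 := Suc k), snd \<sigma>')"
        by (rule memory_cong[OF ys(1)]) simp_all
      moreover have "\<forall>k'<Suc k. t \<notin> reach adjs s k'" using g(1) I(6) less_Suc_eq by auto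
      ultimately have "I (R - Suc k) ((fst \<sigma>')(2 := Suc k), snd \<sigma>')"
        using g(2) unfolding I_def by (intro exI[of _ "xs @ ys"]) (simp del: set_append reach.simps)
      then show ?thesis by (intro runs_Assign) (simp, unfold *)
    qed
    show "\<exists>m'. m = Suc m' \<and> runs w ?body \<sigma> (N * (lam * 40 + 40) + 20) (I m')"
    proof (intro exI conjI)
      show "m = Suc (R - Suc k)" using I(5) g(2) by simp
      show "runs w ?body \<sigma> (N * (lam * 40 + 40) + 20) (I (R - Suc k))"
        apply (rule runs_Seq[where ?T1.0 = 3 and ?T2.0 = "N * (lam * 40 + 40) + 15"])
         apply (rule runs_Assign)
          apply simp
         apply (rule runs_Seq[where ?T1.0 = 3 and ?T2.0 = "N * (lam * 40 + 40) + 12"])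
          apply (rule runs_Assign)
           apply simp
          apply (rule runs_Seq[where ?T1.0 = "N * (lam * 40 + 40) + 4" and ?T2.0 = 5])
        subgoal
          using runs_mono[OF round order_refl last] mem by simp
           apply simp_all
        done
    qed
  qed
  have 1: "exp_val w (mark_addr (Reg 0)) \<sigma> = length D + s"
    if "fst \<sigma> 0 = s" "snd \<sigma> 0 = length D" for \<sigma> :: state
    using that cells assms(2) by (auto simp: addr_defs intro!: mod_less)
  have 2: "exp_val w (list_addr (Const 0)) \<sigma> = length D + n" if "snd \<sigma> (Suc 0) = length D + n" for \<sigma>
    using that cells one by (auto simp: addr_defs intro!: mod_less)
  let ?\<sigma> = "((fst \<sigma>)(2 := 0, 3 := 1), (snd \<sigma>)(length D + s := 1, length D + n := s))"
  have "memory s t [s] ?\<sigma>" using assms D0 D1 len unfolding memory_def initial_def by auto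
  from loop[OF this] have loop: "runs w (While ?guard ?body) ?\<sigma> (R * (N * (lam * 40 + 40) + 40) + 20)
      (\<lambda>\<sigma>'. \<exists>xs k. memory s t xs \<sigma>' \<and> fst \<sigma>' 2 = k \<and> set xs = reach adjs s k \<and> k \<le> R \<and>
       (t \<in> reach adjs s k \<or> k = R) \<and> (\<forall>k'<k. t \<notin> reach adjs s k'))" by simp
  have init: "fst \<sigma> 0 = s" "snd \<sigma> 0 = length D" "snd \<sigma> (Suc 0) = length D + n"
    using assms(1) D0 D1 pos by (auto simp: initial_def)
  show ?thesis unfolding bfs_def
    apply (rule runs_Seq[where ?T1.0 = 7 and ?T2.0 = "R * (N * (lam * 40 + 40) + 40) + 45"])
     apply (rule runs_Store)
      apply (simp add: addr_defs)
     apply (rule runs_Seq[where ?T1.0 = 7 and ?T2.0 = "R * (N * (lam * 40 + 40) + 40) + 38"])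
      apply (rule runs_Store)
       apply (simp add: addr_defs)
      apply (rule runs_Seq[where ?T1.0 = 3 and ?T2.0 = "R * (N * (lam * 40 + 40) + 40) + 35"])
       apply (rule runs_Assign)
        apply simp
       apply (rule runs_Seq[where ?T1.0 = 3 and ?T2.0 = "R * (N * (lam * 40 + 40) + 40) + 30"])
        apply (rule runs_Assign)
         apply simp
    subgoal
      using runs_mono[OF loop, of "R * (N * (lam * 40 + 40) + 40) + 30"] 1[of \<sigma>] init one pos
        2[of "(fst \<sigma>, (snd \<sigma>)(length D + s := Suc 0))"]
      by simp
       apply simp_all
    done
qed

text \<open>Naming the first match \<open>j\<close> gives both termination and the bound on the
  iterations. All entries up to it lie inside \<open>D\<close>, so no address wraps.\<close>

lemma label_search_runs:
  assumes "fst \<sigma> 0 = s" "fst \<sigma> 1 = t" "\<And>a. a < length D \<Longrightarrow> snd \<sigma> a = D ! a" "s < n" "t < n"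
    and p: "p = D ! (5 + 3 * s)" "p + 3 * J \<le> length D" and q: "q = D ! (5 + 3 * t)" "q + 3 * J \<le> length D"
    and j: "j < J" "D ! (p + 3 * j) = D ! (q + 3 * j + 1)" 
    and before: "\<And>i. i < j \<Longrightarrow> D ! (p + 3 * i) \<noteq> D ! (q + 3 * i + 1)"
  shows "runs w label_search \<sigma> (J * 30 + 50) (\<lambda>\<sigma>. fst \<sigma> 0 = D ! (p + 3 * j + 2))"
proof -
  define I where "I = (\<lambda>k (\<sigma>' :: state). \<exists>i. i \<le> j \<and> k = j - i \<and> fst \<sigma>' 2 = p + 3 * i \<and> fst \<sigma>' 3 = q + 3 * i \<and> snd \<sigma>' = snd \<sigma>)"
  have "w > 0" using cells by (cases w) auto
  then have one: "1 mod 2 ^ w = (1::nat)" by simp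
  let ?guard = "Bin Eq (Bin Eq (Load (Reg 2)) (Load (add_exp (Reg 3) (Const 1)))) (Const 0)"
  let ?body = "Seq (Assign 2 (add_exp (Reg 2) (Const 3))) (Assign 3 (add_exp (Reg 3) (Const 3)))"
  have 3: "3 mod 2 ^ w = (3::nat)" "2 mod 2 ^ w = (2::nat)" using cells by (auto intro!: mod_less)
  have loop: "runs w (While ?guard ?body) \<sigma>' (J * 30 + 15)
    (\<lambda>\<sigma>'. fst \<sigma>' 2 = p + 3 * j \<and> snd \<sigma>' = snd \<sigma>)" if "fst \<sigma>' 2 = p" "fst \<sigma>' 3 = q" "snd \<sigma>' = snd \<sigma>" for \<sigma>'
  proof (rule runs_While[where I = I and k = j and B = 10])
    show "I j \<sigma>'" unfolding I_def using that by (intro exI[of _ 0]) simp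
    show "j * (10 + 1 + exp_cost ?guard) + 1 + exp_cost ?guard \<le> J * 30 + 15" using j(1) by simp
    fix k \<sigma>'
    assume "I k \<sigma>'"
    then obtain i where I: "i \<le> j" "k = j - i" "fst \<sigma>' 2 = p + 3 * i" "fst \<sigma>' 3 = q + 3 * i" "snd \<sigma>' = snd \<sigma>"
      unfolding I_def by blast
    have le: "p + 3 * i + 3 \<le> length D" "q + 3 * i + 3 \<le> length D" using p(2) q(2) I(1) j(1) by linarith+
    then have small: "Suc (q + 3 * i) mod 2 ^ w = Suc (q + 3 * i)" "(p + 3 * i + 3) mod 2 ^ w = p + 3 * i + 3"
       "(q + 3 * i + 3) mod 2 ^ w = q + 3 * i + 3"
      using cells by (auto intro!: mod_less)
    have "snd \<sigma> (p + 3 * i) = D ! (p + 3 * i)" "snd \<sigma> (Suc (q + 3 * i)) = D ! (q + 3 * i + 1)"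
      using assms(3) le by auto
    then have guard: "exp_val w ?guard \<sigma>' = (if D ! (p + 3 * i) = D ! (q + 3 * i + 1) then 0 else 1)"
      using I small one by simp
    {
      assume "exp_val w ?guard \<sigma>' = 0"
      then have "i = j" using guard before[of i] I(1) by (cases "i < j") (auto split: if_splits)
      then show "fst \<sigma>' 2 = p + 3 * j \<and> snd \<sigma>' = snd \<sigma>" using I by simp
    }
    assume "exp_val w ?guard \<sigma>' \<noteq> 0"
    then have ij: "i < j" using guard I(1) j(2) by (cases "i = j") (auto split: if_splits)
    show "\<exists>k'. k = Suc k' \<and> runs w ?body \<sigma>' 10 (I k')"
    proof (intro exI conjI)
      show "k = Suc (j - Suc i)" using I(2) ij by simp
      show "runs w ?body \<sigma>' 10 (I (j - Suc i))"
        apply (rule runs_Seq[where ?T1.0 = 5 and ?T2.0 = 5])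
         apply (rule runs_Assign)
          apply simp
         apply (rule runs_Assign)
          apply simp
        subgoal using I ij small 3 unfolding I_def by (intro exI[of _ "Suc i"]) simp
        apply simp
        done
    qed
  qed
  have rec: "2 mod 2 ^ w = (2::nat)" "3 mod 2 ^ w = (3::nat)"
    "(3 * v) mod 2 ^ w = 3 * v" "(3 + 3 * v) mod 2 ^ w = 3 + 3 * v" "Suc (Suc (3 + 3 * v)) mod 2 ^ w = 5 + 3 * v"
    "snd \<sigma> (5 + 3 * v) = D ! (5 + 3 * v)"
    if "v < n" for v
    using that cells len assms(3) by (auto intro!: mod_less)
  have jle: "p + 3 * j + 2 < length D" using p(2) j(1) by linarith
  then have last: "runs w (Assign 0 (Load (add_exp (Reg 2) (Const 2)))) \<sigma>' 6 (\<lambda>\<sigma>. fst \<sigma> 0 = D ! (p + 3 * j + 2))"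
    if "fst \<sigma>' 2 = p + 3 * j \<and> snd \<sigma>' = snd \<sigma>" for \<sigma>'
  proof -
    have "(p + 3 * j + 2) mod 2 ^ w = p + 3 * j + 2" using jle cells by (auto intro!: mod_less)
    then show ?thesis using that assms(3)[OF jle] 3 by (intro runs_Assign) simp_all
  qed
  show ?thesis unfolding label_search_def
    apply (rule runs_Seq[where ?T1.0 = 10 and ?T2.0 = "J * 30 + 31"])
     apply (rule runs_Assign)
      apply (simp add: addr_defs)
     apply (rule runs_Seq[where ?T1.0 = 10 and ?T2.0 = "J * 30 + 21"])
      apply (rule runs_Assign)
       apply (simp add: addr_defs)
      apply (rule runs_Seq[where ?T1.0 = "J * 30 + 15" and ?T2.0 = 6])
    subgoal
      by (rule runs_mono[OF loop order_refl last])
         (use rec[OF assms(4)] rec[OF assms(5)] assms(1,2) p(1) q(1) in \<open>simp_all add: addr_defs\<close>)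
      apply simp_all
    done
qed

text \<open>\<open>Q\<close> stands for the correctness of an answer. Labels are constrained only
  when \<open>t\<close> is beyond the reach of the search, so a data structure without labels is
  admissible if every search succeeds.\<close>

lemma query_runs:
  assumes "initial s t \<sigma>" "s < n" "t < n" "card (reach adjs s R) \<le> N"
    and equal: "s = t \<Longrightarrow> Q 0"
    and near: "\<And>k. k \<le> R \<Longrightarrow> t \<in> reach adjs s k \<Longrightarrow> \<forall>k'<k. t \<notin> reach adjs s k' \<Longrightarrow> Q k"
    and far: "t \<notin> reach adjs s R \<Longrightarrow> \<exists>p q j. p = D ! (5 + 3 * s) \<and> p + 3 * J \<le> length D \<and>
      q = D ! (5 + 3 * t) \<and> q + 3 * J \<le> length D \<and> j < J \<and> D ! (p + 3 * j) = D ! (q + 3 * j + 1) \<and>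
      (\<forall>i<j. D ! (p + 3 * i) \<noteq> D ! (q + 3 * i + 1)) \<and> Q (D ! (p + 3 * j + 2))"
  shows "runs w query \<sigma> (R * (N * (lam * 40 + 40) + 40) + J * 30 + 130) (\<lambda>\<sigma>. Q (fst \<sigma> 0))"
proof -
  have "w > 0" using cells by (cases w) auto
  then have one: "1 mod 2 ^ w = (1::nat)" by simp
  have final: "runs w (If (Load (mark_addr (Reg 1))) (Assign 0 (Reg 2)) label_search) \<sigma> (J * 30 + 60) (\<lambda>\<sigma>. Q (fst \<sigma> 0))"
    if found: "\<exists>xs k. memory s t xs \<sigma> \<and> fst \<sigma> 2 = k \<and> set xs = reach adjs s k \<and> k \<le> R \<and>
       (t \<in> reach adjs s k \<or> k = R) \<and> (\<forall>k'<k. t \<notin> reach adjs s k')" for \<sigma>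
  proof -
    obtain xs k where xs: "memory s t xs \<sigma>" "fst \<sigma> 2 = k" "set xs = reach adjs s k" "k \<le> R"
       "t \<in> reach adjs s k \<or> k = R" "\<forall>k'<k. t \<notin> reach adjs s k'" using found by auto
    have "0 < length D" using len by auto
    then have "snd \<sigma> 0 = length D" "fst \<sigma> (Suc 0) = t" "snd \<sigma> (length D + t) = (if t \<in> set xs then 1 else 0)"
      using xs(1) D0 assms(3) unfolding memory_def by auto
    moreover have "(length D + t) mod 2 ^ w = length D + t" using cells assms(3) by (auto intro!: mod_less)
    ultimately have guard: "exp_val w (Load (mark_addr (Reg 1))) \<sigma> = (if t \<in> reach adjs s k then 1 else 0)"
      using xs(3) by (simp add: addr_defs)
    show ?thesis
    proof (rule runs_If[where T' = "J * 30 + 50"])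
      assume "exp_val w (Load (mark_addr (Reg 1))) \<sigma> \<noteq> 0"
      then have "t \<in> reach adjs s k" using guard by (auto split: if_splits)
      then have "Q k" using near xs by blast
      then show "runs w (Assign 0 (Reg 2)) \<sigma> (J * 30 + 50) (\<lambda>\<sigma>. Q (fst \<sigma> 0))"
        using xs(2) by (intro runs_Assign) simp_all
    next
      assume "exp_val w (Load (mark_addr (Reg 1))) \<sigma> = 0"
      then have "t \<notin> reach adjs s R" using guard xs(5) by (auto split: if_splits)
      from far[OF this] obtain p q j where pqj: "p = D ! (5 + 3 * s)" "p + 3 * J \<le> length D"
        "q = D ! (5 + 3 * t)" "q + 3 * J \<le> length D" "j < J" "D ! (p + 3 * j) = D ! (q + 3 * j + 1)"
        "\<forall>i<j. D ! (p + 3 * i) \<noteq> D ! (q + 3 * i + 1)" "Q (D ! (p + 3 * j + 2))" by blast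
      have "runs w label_search \<sigma> (J * 30 + 50) (\<lambda>\<sigma>. fst \<sigma> 0 = D ! (p + 3 * j + 2))"
        using xs(1) unfolding memory_def
        by (intro label_search_runs[OF _ _ _ assms(2,3) pqj(1,2,3,4,5,6)]) (use pqj(7) in auto)
      then show "runs w label_search \<sigma> (J * 30 + 50) (\<lambda>\<sigma>. Q (fst \<sigma> 0))"
        by (rule runs_mono) (use pqj(8) in auto)
    qed (simp add: addr_defs)
  qed
  have st: "fst \<sigma> 0 = s" "fst \<sigma> (Suc 0) = t" using assms(1) by (auto simp: initial_def)
  show ?thesis unfolding query_def
  proof (rule runs_If[where T' = "R * (N * (lam * 40 + 40) + 40) + J * 30 + 120"])
    assume "exp_val w (Bin Eq (Reg 0) (Reg 1)) \<sigma> \<noteq> 0"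
    then have "Q 0" using st equal by (auto split: if_splits)
    then show "runs w (Assign 0 (Const 0)) \<sigma> (R * (N * (lam * 40 + 40) + 40) + J * 30 + 120) (\<lambda>\<sigma>. Q (fst \<sigma> 0))"
      by (intro runs_Assign) simp_all
  next
    show "runs w (Seq bfs (If (Load (mark_addr (Reg 1))) (Assign 0 (Reg 2)) label_search)) \<sigma>
      (R * (N * (lam * 40 + 40) + 40) + J * 30 + 120) (\<lambda>\<sigma>. Q (fst \<sigma> 0))"
    proof (rule runs_Seq)
      show "runs w bfs \<sigma> (R * (N * (lam * 40 + 40) + 40) + 60) (\<lambda>\<sigma>. runs w
          (If (Load (mark_addr (Reg 1))) (Assign 0 (Reg 2)) label_search) \<sigma> (J * 30 + 60) (\<lambda>\<sigma>. Q (fst \<sigma> 0)))"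
        by (rule runs_mono[OF bfs_runs[OF assms(1-4)] order_refl]) (rule final)
    qed simp
  qed simp
qed

end

section \<open>Distance labels of net points\<close>

text \<open>Entry \<open>i * L + j\<close> of the label of \<open>p\<close>, with \<open>L = lam ^ (\<mu> + 1)\<close> and \<open>j < L\<close>, consists of
  the \<open>j\<close>-th point of the \<open>i\<close>-th net in the ball of radius \<open>r * 2 ^ i * 2 ^ \<mu>\<close> around \<open>p\<close>
  (or of the non-vertex \<open>n\<close>, if there is no such point), the point of the \<open>i\<close>-th net close to \<open>p\<close>, and
  an upper bound for distances realized through the former point. The first match in the labels of \<open>p\<close>
  and \<open>q\<close> is at the lowest usable level, where the failure one level below bounds \<open>d p q\<close> from below.\<close>

lemma labels_exist:
  fixes \<epsilon> :: real and E :: "nat set set"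
  defines "d \<equiv> hop_dist E"
  assumes "unit_graph {..<n} E"
    and r: "r > 0" and diam: "diameter {..<n} E \<le> 2 ^ l"
    and eps: "\<epsilon> > 0" "12 / \<epsilon> + 3 \<le> 2 ^ \<mu>"
    and J: "J = Suc l * doubling_constant {..<n} E ^ (\<mu> + 1)"
  obtains A B DA :: "nat \<Rightarrow> nat \<Rightarrow> nat" where
    "\<And>p m. p < n \<Longrightarrow> A p m \<le> n" "\<And>p m. p < n \<Longrightarrow> B p m \<le> n"
    "\<And>p m. p < n \<Longrightarrow> m < J \<Longrightarrow> DA p m \<le> n + r * 2 ^ l + 2 * r"
    "\<And>s t p q. s < n \<Longrightarrow> t < n \<Longrightarrow> p < n \<Longrightarrow> q < n \<Longrightarrow> d s p \<le> r \<Longrightarrow> d t q \<le> r \<Longrightarrow>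
      r * 2 ^ \<mu> < d s t \<Longrightarrow> \<exists>j<J. A p j = B q j \<and> (\<forall>i<j. A p i \<noteq> B q i) \<and>
        d s t \<le> DA p j \<and> real (DA p j) \<le> (1 + \<epsilon>) * real (d s t)"
proof -
  interpret unit_graph "{..<n}" E by fact
  define L where "L = lam ^ (\<mu> + 1)"
  have JL: "J = Suc l * L" using J by (simp add: L_def)
  have L: "L > 0" using doubling_constant_pos by (simp add: L_def)
  have "\<forall>i. \<exists>N. separated (r * 2 ^ i) N \<and> (\<forall>v<n. \<exists>x\<in>N. d v x \<le> r * 2 ^ i)"
  proof
    fix i
    obtain N where "separated (r * 2 ^ i) N" "\<And>v. v \<in> {..<n} \<Longrightarrow> \<exists>x\<in>N. hop_dist E v x \<le> r * 2 ^ i"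
      using net_exists[of "r * 2 ^ i"] by blast
    then show "\<exists>N. separated (r * 2 ^ i) N \<and> (\<forall>v<n. \<exists>x\<in>N. d v x \<le> r * 2 ^ i)"
      unfolding d_def by blast
  qed
  from choice[OF this] obtain N where N: "\<And>i. separated (r * 2 ^ i) (N i)"
    "\<And>i v. v < n \<Longrightarrow> \<exists>x\<in>N i. d v x \<le> r * 2 ^ i" by blast
  define near where "near i v = (SOME x. x \<in> N i \<and> d v x \<le> r * 2 ^ i)" for i v
  have near: "near i v \<in> N i" "d v (near i v) \<le> r * 2 ^ i" if "v < n" for i v
    using someI_ex[of "\<lambda>x. x \<in> N i \<and> d v x \<le> r * 2 ^ i"] N(2)[OF that, of i] by (auto simp: near_def)
  have NV: "x < n" if "x \<in> N i" for x i using N(1)[of i] that by (auto simp: separated_def)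
  define pts where "pts i p = sorted_list_of_set {x \<in> N i. d p x \<le> r * 2 ^ i * 2 ^ \<mu>}" for i p
  have fin: "finite {x \<in> N i. P x}" for i P using NV by (auto intro: finite_subset[of _ "{..<n}"])
  have pts: "length (pts i p) \<le> L" "set (pts i p) = {x \<in> N i. d p x \<le> r * 2 ^ i * 2 ^ \<mu>}" if "p < n" for i p
    using separated_card_ball[OF N(1)[of i], of p \<mu>] that fin by (auto simp: pts_def L_def d_def)
  \<comment> \<open>The default \<open>n\<close> is not a vertex, while \<open>B\<close> lists only
    vertices; empty places therefore never match.\<close>
  define A where "A p m = (if m mod L < length (pts (m div L) p) then pts (m div L) p ! (m mod L) else n)" for p m
  define B where "B p m = near (m div L) p" for p m
  \<comment> \<open>After \<open>d p x\<close> for the listed point \<open>x\<close>, the second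
    term pays for the way from \<open>x\<close> to \<open>q\<close>, and \<open>2 * r\<close> for
    the moves from \<open>s\<close> to \<open>p\<close> and from \<open>q\<close> to
    \<open>t\<close>.\<close>
  define DA where "DA p m = (if A p m < n then d p (A p m) + r * 2 ^ (m div L) + 2 * r else 0)" for p m
  have level: "m div L \<le> l" if "m < J" for m
    using that L unfolding JL by (simp add: less_mult_imp_div_less less_Suc_eq_le[symmetric])
  have found: "\<exists>m. m div L = i \<and> A p m = B q m"
    if "p < n" "q < n" "d p (near i q) \<le> r * 2 ^ i * 2 ^ \<mu>" for i p q
  proof -
    have "near i q \<in> set (pts i p)" using that near pts(2) by simp
    then obtain c where c: "c < length (pts i p)" "pts i p ! c = near i q" by (meson in_set_conv_nth)
    then have "c < L" using pts(1)[of p i] that by simp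
    then show ?thesis using c by (intro exI[of _ "i * L + c"]) (simp add: A_def B_def)
  qed
  show ?thesis
  proof (rule that[of A B DA])
    fix p m assume p: "p < n"
    show "A p m \<le> n"
    proof (cases "m mod L < length (pts (m div L) p)")
      case True
      then have "pts (m div L) p ! (m mod L) \<in> set (pts (m div L) p)" by simp
      then show ?thesis using pts(2) p NV True by (fastforce simp: A_def)
    qed (simp add: A_def)
    show "B p m \<le> n" using NV[OF near(1)[OF p]] by (simp add: B_def less_imp_le)
    assume "m < J"
    then have *: "r * 2 ^ (m div L) \<le> r * 2 ^ l" using level by (intro mult_left_mono power_increasing) auto
    show "DA p m \<le> n + r * 2 ^ l + 2 * r"
    proof (cases "A p m < n")
      case True
      then have "d p (A p m) \<le> n" using hop_dist_less_card[of p "A p m"] p by (simp add: d_def)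
      then show ?thesis using * unfolding DA_def if_P[OF True] by linarith
    qed (simp add: DA_def)
  next
    fix s t p q
    assume stpq: "s < n" "t < n" "p < n" "q < n" and near_pq: "d s p \<le> r" "d t q \<le> r"
      and far: "r * 2 ^ \<mu> < d s t"
    have tri: "d u w \<le> d u v + d v w" if "u < n" "v < n" "w < n" for u v w
      using hop_dist_triangle[of u v w] that by (simp add: d_def)
    have sym: "d u v = d v u" if "u < n" "v < n" for u v
      using hop_dist_commute[of u v] that by (simp add: d_def)
    have near_n: "near i q < n" for i using NV[OF near(1)[OF stpq(4)]] .
    \<comment> \<open>At the top level the listed ball exceeds the diameter, so some match
      exists.\<close>
    have "d p (near l q) \<le> 2 ^ l"
      using hop_dist_le_diameter[of p "near l q"] diam near_n stpq by (simp add: d_def)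
    also have "(2::nat) ^ l \<le> r * 2 ^ l * 2 ^ \<mu>" using r by simp
    finally obtain m where m: "m div L = l" "A p m = B q m" using found stpq by blast
    define j where "j = (LEAST m. A p m = B q m)"
    have j: "A p j = B q j" unfolding j_def by (rule LeastI[of "\<lambda>m. A p m = B q m", OF m(2)])
    have before: "A p i \<noteq> B q i" if "i < j" for i using not_less_Least[of i "\<lambda>m. A p m = B q m"] that by (simp add: j_def)
    have "j \<le> m" unfolding j_def by (rule Least_le[of "\<lambda>m. A p m = B q m", OF m(2)])
    also have "m < J"
      using m(1) L dividend_less_div_times[of L m] by (simp add: JL mult.commute)
    finally have jJ: "j < J" .
    define i where "i = j div L"
    define x where "x = near i q"
    have x: "A p j = x" "x < n" "d q x \<le> r * 2 ^ i"
      using j near_n near(2)[OF stpq(4)] by (auto simp: B_def x_def i_def)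
    have DA: "DA p j = d p x + r * 2 ^ i + 2 * r" using x by (simp add: DA_def i_def)
    have lower: "d s t \<le> DA p j"
      using tri[of s p t] tri[of p x t] tri[of x q t] sym[of x q] sym[of q t] near_pq x DA stpq by linarith
    have pq: "d p q \<le> d s t + 2 * r"
      using tri[of p s q] tri[of s t q] sym[of p s] near_pq stpq by linarith
    have "d p x \<le> d p q + r * 2 ^ i" using tri[of p q x] x stpq by linarith
    then have "DA p j \<le> d s t + 4 * r + 2 * (r * 2 ^ i)" using DA pq by linarith
    then have "real (DA p j) \<le> real (d s t + 4 * r + 2 * (r * 2 ^ i))" by (simp only: of_nat_le_iff)
    then have upper: "real (DA p j) \<le> d s t + 4 * r + 2 * (r * 2 ^ i)" by simp
    \<comment> \<open>The 12 covers the absolute error, which is at most \<open>6 * r\<close> at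
      level 0 and \<open>4 * r + 4 * Y\<close> above, where \<open>r \<le> Y\<close>. The 3 stems
      from the loss \<open>2 * r + Y\<close> in passing from the distance between \<open>p\<close>
      and the net point near \<open>q\<close> to \<open>d s t\<close>.\<close>
    have eM: "12 \<le> \<epsilon> * (2 ^ \<mu> - 3)" using eps by (simp add: field_simps)
    have "real (DA p j) \<le> (1 + \<epsilon>) * real (d s t)"
    \<comment> \<open>Level 0 has no level below it; there the lower bound on \<open>d s t\<close>
      is that of the failed search.\<close>
    proof (cases i)
      case 0
      have "6 * real r \<le> \<epsilon> * (2 ^ \<mu> - 3) * r" using eM by (intro mult_right_mono) auto
      also have "\<dots> \<le> \<epsilon> * (r * 2 ^ \<mu>)" using eps by (simp add: algebra_simps)
      also have "\<dots> \<le> \<epsilon> * d s t"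
      proof -
        have "real (r * 2 ^ \<mu>) \<le> d s t" using far by (simp only: of_nat_le_iff)
        then show ?thesis using eps by simp
      qed
      finally show ?thesis using upper 0 by (simp add: algebra_simps)
    next
      case (Suc i')
      define Y where "Y = r * 2 ^ i'"
      have "\<not> d p (near i' q) \<le> r * 2 ^ i' * 2 ^ \<mu>"
      proof
        assume "d p (near i' q) \<le> r * 2 ^ i' * 2 ^ \<mu>"
        then obtain m where m: "m div L = i'" "A p m = B q m" using found stpq by blast
        \<comment> \<open>Entries are ordered in blocks of length \<open>L\<close> by level, so a
          match at level \<open>i'\<close> would precede \<open>j\<close>.\<close>
        have "m < j"
        proof (rule ccontr)
          assume "\<not> m < j"
          then have "i \<le> i'" using m(1) div_le_mono[of j m L] by (simp add: i_def)
          then show False using Suc by simp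
        qed
        then show False using before m(2) by blast
      qed
      then have "Y * 2 ^ \<mu> < d p (near i' q)" by (simp add: Y_def)
      also have "\<dots> \<le> d p q + Y"
        using tri[of p q "near i' q"] near(2)[OF stpq(4), of i'] near_n stpq by (simp add: Y_def)
      finally have "Y * 2 ^ \<mu> \<le> d s t + 2 * r + Y" using pq by linarith
      moreover have rY: "r \<le> Y" by (simp add: Y_def)
      ultimately have "Y * 2 ^ \<mu> \<le> d s t + 3 * Y" by linarith
      then have "real (Y * 2 ^ \<mu>) \<le> real (d s t + 3 * Y)" by (simp only: of_nat_le_iff)
      then have Y: "real Y * (2 ^ \<mu> - 3) \<le> real (d s t)" by (simp add: algebra_simps)
      have "real (DA p j) \<le> d s t + 4 * r + 4 * real Y" using upper Suc by (simp add: Y_def mult_ac)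
      also have "\<dots> \<le> d s t + 12 * real Y" using rY by simp
      also have "12 * real Y \<le> \<epsilon> * (2 ^ \<mu> - 3) * Y" using eM by (intro mult_right_mono) auto
      also have "\<dots> \<le> \<epsilon> * d s t" using mult_left_mono[OF Y, of \<epsilon>] eps by (simp add: mult_ac)
      finally show ?thesis by (simp add: algebra_simps)
    qed
    then show "\<exists>j<J. A p j = B q j \<and> (\<forall>i<j. A p i \<noteq> B q i) \<and>
        d s t \<le> DA p j \<and> real (DA p j) \<le> (1 + \<epsilon>) * real (d s t)"
      using j before lower jJ by blast
  qed
qed

section \<open>The data structure\<close>

lemma nth_concat:
  "i < length xss \<Longrightarrow> j < length (xss ! i) \<Longrightarrow>
   concat xss ! (sum_list (map length (take i xss)) + j) = xss ! i ! j"
  by (induction xss arbitrary: i) (auto simp: nth_Cons nth_append split: nat.split)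

lemma sum_list_length_take_uniform:
  "\<forall>xs\<in>set xss. length xs = k \<Longrightarrow> i \<le> length xss \<Longrightarrow> sum_list (map length (take i xss)) = i * k"
  by (induction xss arbitrary: i) (auto simp: take_Cons split: nat.split)

lemma nth_concat_uniform:
  "\<forall>xs\<in>set xss. length xs = k \<Longrightarrow> i < length xss \<Longrightarrow> j < k \<Longrightarrow> concat xss ! (i * k + j) = xss ! i ! j"
  using nth_concat[of i xss j] sum_list_length_take_uniform[of xss k i] by (simp add: nth_mem)

lemma length_concat_uniform:
  "\<forall>xs\<in>set xss. length xs = k \<Longrightarrow> length (concat xss) = length xss * k"
  using sum_list_length_take_uniform[of xss k "length xss"] by (simp add: length_concat)

section \<open>The memory layout\<close>

definition edge_start :: "nat \<Rightarrow> nat list list \<Rightarrow> nat \<Rightarrow> nat" where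
  "edge_start n nbs v = 3 + 3 * n + sum_list (map length (take v nbs))"

definition label_start :: "nat \<Rightarrow> nat list list \<Rightarrow> nat \<Rightarrow> nat \<Rightarrow> nat" where
  "label_start n nbs J k = 3 + 3 * n + length (concat nbs) + k * (3 * J)"

text \<open>The first two cells point just behind the list: the marks and the list of marked
  vertices live in zero-initialized working memory, so they cost no space and the marks start out
  clear.\<close>

definition layout :: "nat \<Rightarrow> nat \<Rightarrow> nat list list \<Rightarrow> nat \<Rightarrow> (nat \<Rightarrow> nat) \<Rightarrow> nat list list \<Rightarrow> nat list" where
  "layout n R nbs J idx labs =
    (let len = 3 + 3 * n + length (concat nbs) + length (concat labs) in
     [len, len + n, R] @
     concat (map (\<lambda>v. [edge_start n nbs v, edge_start n nbs v + length (nbs ! v), label_start n nbs J (idx v)]) [0..<n]) @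
     concat nbs @ concat labs)"

context
  fixes n R J :: nat and nbs labs :: "nat list list" and idx :: "nat \<Rightarrow> nat"
  assumes nbs: "length nbs = n" and labs: "\<forall>xs\<in>set labs. length xs = 3 * J"
begin

abbreviation "D \<equiv> layout n R nbs J idx labs"
abbreviation "recs \<equiv> map (\<lambda>v. [edge_start n nbs v, edge_start n nbs v + length (nbs ! v), label_start n nbs J (idx v)]) [0..<n]"

lemma length_recs: "length (concat recs) = 3 * n"
  by (subst length_concat_uniform[where k = 3]) auto

lemma length_layout: "length D = 3 + 3 * n + length (concat nbs) + length labs * (3 * J)"
  using length_recs length_concat_uniform[OF labs] by (simp add: layout_def Let_def)

lemma layout_header: "D ! 0 = length D" "D ! 1 = length D + n" "D ! 2 = R"
  using length_recs by (simp_all add: layout_def Let_def)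

lemma layout_record:
  assumes "v < n"
  shows "D ! (3 + 3 * v) = edge_start n nbs v" "D ! (4 + 3 * v) = edge_start n nbs v + length (nbs ! v)"
    "D ! (5 + 3 * v) = label_start n nbs J (idx v)"
proof -
  have "D ! (3 + 3 * v + c) = recs ! v ! c" if "c < 3" for c
  proof -
    have "v * 3 + c < length (concat recs)" using assms that length_recs by simp
    moreover have "concat recs ! (v * 3 + c) = recs ! v ! c"
      using assms that by (intro nth_concat_uniform) auto
    ultimately show ?thesis by (simp add: layout_def Let_def nth_append mult.commute)
  qed
  from this[of 0] this[of 1] this[of 2] show "D ! (3 + 3 * v) = edge_start n nbs v"
    "D ! (4 + 3 * v) = edge_start n nbs v + length (nbs ! v)" "D ! (5 + 3 * v) = label_start n nbs J (idx v)"
    using assms by (simp_all add: eval_nat_numeral)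
qed

lemma layout_tail: "D ! (3 + 3 * n + a) = (concat nbs @ concat labs) ! a"
  using length_recs by (simp add: layout_def Let_def nth_append)

lemma sum_list_take_le:
  "v < n \<Longrightarrow> sum_list (map length (take v nbs)) + length (nbs ! v) \<le> length (concat nbs)"
proof -
  assume "v < n"
  then have "nbs = take v nbs @ nbs ! v # drop (Suc v) nbs" using nbs by (simp add: id_take_nth_drop)
  then have "length (concat nbs) = length (concat (take v nbs @ nbs ! v # drop (Suc v) nbs))" by simp
  then show ?thesis by (simp add: length_concat)
qed

lemma layout_edges:
  assumes "v < n"
  shows "edge_start n nbs v + length (nbs ! v) \<le> length D"
    "(!) D ` {edge_start n nbs v..<edge_start n nbs v + length (nbs ! v)} = set (nbs ! v)"
proof -
  show "edge_start n nbs v + length (nbs ! v) \<le> length D"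
    using sum_list_take_le[OF assms] by (simp add: length_layout edge_start_def)
  have "D ! (edge_start n nbs v + c) = nbs ! v ! c" if "c < length (nbs ! v)" for c
    using layout_tail[of "sum_list (map length (take v nbs)) + c"] nth_concat[of v nbs c] assms that nbs
      sum_list_take_le[OF assms] by (simp add: edge_start_def nth_append add.assoc)
  moreover have "{edge_start n nbs v..<edge_start n nbs v + length (nbs ! v)} = (+) (edge_start n nbs v) ` {..<length (nbs ! v)}"
    by (simp add: lessThan_atLeast0 add.commute)
  ultimately have "(!) D ` {edge_start n nbs v..<edge_start n nbs v + length (nbs ! v)} = (!) (nbs ! v) ` {..<length (nbs ! v)}"
    by (simp add: image_image)
  then show "(!) D ` {edge_start n nbs v..<edge_start n nbs v + length (nbs ! v)} = set (nbs ! v)"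
    by (simp add: set_conv_nth image_def) blast
qed

lemma layout_label:
  assumes "k < length labs"
  shows "label_start n nbs J k + 3 * J \<le> length D"
    "c < 3 * J \<Longrightarrow> D ! (label_start n nbs J k + c) = labs ! k ! c"
proof -
  have "Suc k * (3 * J) \<le> length labs * (3 * J)" using assms by (intro mult_right_mono) auto
  then show "label_start n nbs J k + 3 * J \<le> length D" by (simp add: label_start_def length_layout)
  show "c < 3 * J \<Longrightarrow> D ! (label_start n nbs J k + c) = labs ! k ! c"
    using layout_tail[of "length (concat nbs) + k * (3 * J) + c"] nth_concat_uniform[OF labs assms, of c]
    by (simp add: label_start_def nth_append add.assoc)
qed

text \<open>For checking that all cells fit into words. Equality \<open>idx v = length labs\<close>
  is allowed for the structure without labels, where both are 0.\<close>

lemma set_layout: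
  assumes "x \<in> set D" "\<And>v. v < n \<Longrightarrow> idx v \<le> length labs"
  shows "x \<le> length D + n \<or> x = R \<or> x \<in> set (concat nbs) \<or> x \<in> set (concat labs)"
proof -
  have "edge_start n nbs v + length (nbs ! v) \<le> length D \<and> label_start n nbs J (idx v) \<le> length D" if "v < n" for v
    using layout_edges(1)[OF that] assms(2)[OF that] by (simp add: label_start_def length_layout)
  moreover have "x \<in> {length D, length D + n, R} \<union> set (concat recs) \<union> set (concat nbs) \<union> set (concat labs)"
    using assms(1) length_recs unfolding layout_def Let_def by auto
  ultimately show ?thesis by fastforce
qed

end

section \<open>Time and space bounds\<close>

lemma power_of_two_between:
  assumes "(x::real) \<ge> 1"
  obtains k :: nat where "x \<le> 2 ^ k" "2 ^ k \<le> 2 * x"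
proof -
  define k where "k = (LEAST k. x \<le> 2 ^ k)"
  have k: "x \<le> 2 ^ k"
    unfolding k_def using LeastI_ex[of "\<lambda>k. x \<le> 2 ^ k"] real_arch_pow[of 2 x] by (auto intro: less_imp_le)
  moreover have "2 ^ k \<le> 2 * x"
  proof (cases k)
    case (Suc j)
    then have "\<not> x \<le> 2 ^ j" using not_less_Least[of j "\<lambda>k. x \<le> 2 ^ k"] by (simp add: k_def)
    then show ?thesis using Suc by simp
  qed (use assms in simp)
  ultimately show ?thesis using that by blast
qed

text \<open>With \<lambda> = 2 powr \<alpha>, the power \<open>lam ^ (k + 2)\<close> is at most (8
  Z) powr \<alpha>, and so is \<open>Z\<close> because \<alpha> is at least 1. The time is thus at
  most 280 times (8 Z) powr (2 \<alpha>), and 8 Z is at most G powr 2 * e powr (16 \<alpha>), which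
  gives the exponents 4 \<alpha> and 32 \<alpha>^2.\<close>

lemma query_time_le:
  fixes \<epsilon> :: real
  assumes lam: "lam \<ge> 2" and eps: "\<epsilon> > 0" and diam: "\<Delta> \<ge> 1"
    and l: "2 ^ l \<le> 2 * real \<Delta>" and mu: "2 ^ \<mu> \<le> 2 * (12 / \<epsilon> + 3)" and J: "J = Suc l * lam ^ (\<mu> + 1)"
    and Z: "R \<le> J * 2 ^ \<mu>" and k: "2 ^ k \<le> 2 * real (J * 2 ^ \<mu>)"
  shows "real (R * (lam ^ (k + 1) * (lam * 40 + 40) + 40) + J * 30 + 130)
    \<le> query_time_bound 280 4 32 \<Delta> (log 2 (real lam)) \<epsilon>"
proof -
  define \<alpha> where "\<alpha> = log 2 (real lam)"
  define G where "G = max 2 (log 2 (real \<Delta>))"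
  define e where "e = max 2 (1 / \<epsilon>)"
  define Z where "Z = J * 2 ^ \<mu>"
  have \<alpha>: "1 \<le> \<alpha>" using lam by (simp add: \<alpha>_def)
  have lam_powr: "real lam ^ i = (2 ^ i) powr \<alpha>" for i
  proof -
    have "real lam = 2 powr \<alpha>" using lam by (simp add: \<alpha>_def)
    then show ?thesis by (simp add: powr_powr powr_realpow[symmetric] mult.commute)
  qed
  have G: "2 \<le> G" and e: "2 \<le> e" by (auto simp: G_def e_def)
  have Z1: "1 \<le> Z" using lam by (simp add: Z_def J Suc_le_eq del: mult_Suc power_Suc)
  have JZ: "J \<le> Z" by (simp add: Z_def)
  have RZ: "R \<le> Z" using assms(7) by (simp add: Z_def)
  define M where "M = Z * lam ^ (k + 2)"
  have "R * (lam ^ (k + 1) * (lam * 40 + 40) + 40) + J * 30 + 130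
      \<le> Z * (lam ^ (k + 1) * (lam * 40 + 40) + 40) + Z * 30 + Z * 130"
    using RZ JZ Z1 by (intro add_mono mult_mono) auto
  also have "\<dots> = Z * (lam ^ (k + 1) * (lam * 40 + 40) + 200)" by (simp add: algebra_simps)
  also have "\<dots> \<le> Z * (lam ^ (k + 1) * (lam * 80) + 200 * (lam ^ (k + 2)))"
    using lam by (intro mult_left_mono add_mono) auto
  \<comment> \<open>280 is 80 from the edge scans plus 200 = 40 + 30 + 130 from the remaining
    terms.\<close>
  also have "\<dots> = 280 * M" by (simp add: M_def algebra_simps)
  finally have "real (R * (lam ^ (k + 1) * (lam * 40 + 40) + 40) + J * 30 + 130) \<le> real (280 * M)"
    by (simp only: of_nat_le_iff)
  moreover have "real M \<le> (8 * real Z) powr (2 * \<alpha>)"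
  proof -
    have "real lam ^ (k + 2) = (2 ^ (k + 2)) powr \<alpha>" by (rule lam_powr)
    also have "\<dots> \<le> (8 * real Z) powr \<alpha>" using k \<alpha> by (intro powr_mono2) (auto simp: Z_def)
    finally have "real lam ^ (k + 2) \<le> (8 * real Z) powr \<alpha>" .
    moreover have "real Z \<le> (8 * real Z) powr \<alpha>"
    proof -
      have "real Z \<le> (8 * real Z) powr 1" by simp
      also have "\<dots> \<le> (8 * real Z) powr \<alpha>" using \<alpha> Z1 by (intro powr_mono) auto
      finally show ?thesis .
    qed
    ultimately have "real Z * real lam ^ (k + 2) \<le> (8 * real Z) powr \<alpha> * (8 * real Z) powr \<alpha>"
      by (intro mult_mono) auto
    then show ?thesis by (simp add: M_def powr_add[symmetric])
  qed
  \<comment> \<open>Since \<open>G\<close> and \<open>e\<close> are at least 2, constant factors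
    become powers of them. The exponent of \<open>e\<close> is \<open>7 * \<alpha>\<close> from the
    power of \<open>lam\<close>, 6 from \<open>2 ^ \<mu>\<close> and 3 from the factor 8, at most
    \<open>16 * \<alpha>\<close> in total.\<close>
  moreover have "8 * real Z \<le> G powr 2 * e powr (16 * \<alpha>)"
  proof -
    have "2 ^ \<mu> \<le> 24 * (1 / \<epsilon>) + 6" using mu by simp
    also have "\<dots> \<le> 24 * e + 3 * e" using e by (intro add_mono) (auto simp: e_def)
    also have "\<dots> \<le> 2 ^ 5 * e" using e by simp
    also have "\<dots> \<le> e ^ 5 * e" using e by (intro mult_right_mono power_mono) auto
    finally have mu6: "2 ^ \<mu> \<le> e ^ 6" by (simp add: power_Suc2[symmetric] del: power_Suc power_Suc2)
    have "2 ^ (\<mu> + 1) \<le> e ^ 6 * e" using mult_mono[OF e mu6] e by (simp add: mult.commute)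
    then have mu7: "2 ^ (\<mu> + 1) \<le> e ^ 7" by (simp add: power_Suc2[symmetric] del: power_Suc power_Suc2)
    have "real l \<le> log 2 (2 * real \<Delta>)" using l diam by (subst le_log_iff) (auto simp: powr_realpow)
    then have "real (Suc l) \<le> 2 + log 2 (real \<Delta>)" using diam by (simp add: log_mult)
    also have "\<dots> \<le> 2 * G" by (simp add: G_def)
    also have "\<dots> \<le> G powr 2" using G by (simp add: power2_eq_square)
    finally have l2: "real (Suc l) \<le> G powr 2" .
    have "real lam ^ (\<mu> + 1) = (2 ^ (\<mu> + 1)) powr \<alpha>" by (rule lam_powr)
    also have "\<dots> \<le> (e ^ 7) powr \<alpha>" using mu7 \<alpha> by (intro powr_mono2) auto
    also have "\<dots> = (e powr 7) powr \<alpha>" using e by simp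
    also have "\<dots> = e powr (7 * \<alpha>)" by (rule powr_powr)
    finally have lam7: "real lam ^ (\<mu> + 1) \<le> e powr (7 * \<alpha>)" .
    have "real Z = real (Suc l) * real lam ^ (\<mu> + 1) * 2 ^ \<mu>" by (simp add: Z_def J algebra_simps)
    also have "\<dots> \<le> G powr 2 * e powr (7 * \<alpha>) * e ^ 6"
      using l2 lam7 mu6 by (intro mult_mono) auto
    finally have "8 * real Z \<le> 2 ^ 3 * (G powr 2 * e powr (7 * \<alpha>) * e ^ 6)" by simp
    also have "\<dots> \<le> e ^ 3 * (G powr 2 * e powr (7 * \<alpha>) * e ^ 6)"
      using e by (intro mult_right_mono power_mono) auto
    also have "\<dots> = G powr 2 * (e powr (7 * \<alpha>) * e ^ 9)" by (simp add: mult_ac power_add[symmetric])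
    also have "\<dots> = G powr 2 * e powr (7 * \<alpha> + 9)" using e by (simp add: powr_add)
    also have "\<dots> \<le> G powr 2 * e powr (16 * \<alpha>)" using e \<alpha> by (intro mult_left_mono powr_mono) auto
    finally show ?thesis .
  qed
  ultimately have "real (R * (lam ^ (k + 1) * (lam * 40 + 40) + 40) + J * 30 + 130)
      \<le> 280 * (G powr 2 * e powr (16 * \<alpha>)) powr (2 * \<alpha>)"
    using powr_mono2[of "2 * \<alpha>" "8 * real Z" "G powr 2 * e powr (16 * \<alpha>)"] \<alpha> by simp
  also have "(G powr 2 * e powr (16 * \<alpha>)) powr (2 * \<alpha>) = G powr (4 * \<alpha>) * e powr (32 * \<alpha>\<^sup>2)"
    using G e by (simp add: powr_mult powr_powr power2_eq_square mult_ac del: powr_numeral)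
  finally show ?thesis
    by (simp add: query_time_bound_def \<alpha>_def[symmetric] G_def[symmetric] e_def[symmetric] mult.assoc)
qed

lemma word_size_ge: "(n + 1) ^ c \<le> 2 ^ word_size c n"
proof -
  define k where "k = nat \<lceil>log 2 (real n + 1)\<rceil>"
  have "log 2 (real n + 1) \<le> real k" by (simp add: k_def)
  then have "real n + 1 \<le> 2 ^ k" by (simp add: log_le_iff powr_realpow)
  then have "real (n + 1) \<le> real (2 ^ k)" by simp
  then have "n + 1 \<le> 2 ^ k" by (simp only: of_nat_le_iff)
  then have "(n + 1) ^ c \<le> (2 ^ k) ^ c" by (intro power_mono) auto
  then show ?thesis by (simp add: word_size_def k_def power_mult[symmetric] mult.commute)
qed

section \<open>Assembling the oracle\<close>

lemma reach_eq_ball: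
  assumes "unit_graph {..<n} E" "s < n"
  shows "reach (\<lambda>v. {w. (v, w) \<in> adj E}) s k = {v \<in> {..<n}. hop_dist E s v \<le> k}"
proof -
  interpret unit_graph "{..<n}" E by fact
  show ?thesis
  proof (induction k)
    case 0
    then show ?case using hop_dist_eq_0[of s] assms(2) by auto
  next
    case (Suc k)
    then show ?case using ball_Suc[of s k] assms(2) by (simp only: reach.simps lessThan_iff)
  qed
qed

lemma oracle_exists:
  fixes \<epsilon> :: real
  assumes unit_graph: "unit_graph {..<n} E" and n: "n \<ge> 2" and eps: "\<epsilon> > 0"
  obtains D where "length D \<le> 23 * card E"
    "approx_distance_oracle (word_size 6 n) query D {..<n} E \<epsilon>
       (query_time_bound 280 4 32 (diameter {..<n} E) (doubling_dimension {..<n} E) \<epsilon>)"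
proof -
  interpret unit_graph "{..<n}" E by fact
  define \<Delta> where "\<Delta> = diameter {..<n} E"
  define adjs where "adjs v = {w. (v, w) \<in> adj E}" for v
  have lam: "lam \<ge> 2" using doubling_constant_ge_2 n by simp
  have Delta_n: "\<Delta> < n" using diameter_less_card by (simp add: \<Delta>_def)
  have Delta: "\<Delta> \<ge> 1"
  proof -
    have "d 0 1 \<noteq> 0" using hop_dist_eq_0[of 0 1] n by simp
    then show ?thesis using hop_dist_le_diameter[of 0 1] n by (simp add: \<Delta>_def)
  qed
  obtain l where l: "real \<Delta> \<le> 2 ^ l" "2 ^ l \<le> 2 * real \<Delta>" using power_of_two_between[of "real \<Delta>"] Delta by auto
  have "1 \<le> 12 / \<epsilon> + 3" using eps by (simp add: add_nonneg_pos le_add_same_cancel2)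
  then obtain \<mu> where \<mu>: "12 / \<epsilon> + 3 \<le> 2 ^ \<mu>" "2 ^ \<mu> \<le> 2 * (12 / \<epsilon> + 3)" using power_of_two_between by blast
  define J where "J = Suc l * lam ^ (\<mu> + 1)"
  have J: "J > 0" using lam by (simp add: J_def)
  have l_nat: "\<Delta> \<le> 2 ^ l" "2 ^ l \<le> 2 * \<Delta>"
  proof -
    have "real \<Delta> \<le> real (2 ^ l)" "real (2 ^ l) \<le> real (2 * \<Delta>)" using l by simp_all
    then show "\<Delta> \<le> 2 ^ l" "2 ^ l \<le> 2 * \<Delta>" by (simp_all only: of_nat_le_iff)
  qed
  define Z where "Z = J * 2 ^ \<mu>"
  \<comment> \<open>The cap makes the radius fit into a word for every \<epsilon>; it loses nothing,
    as all distances are below \<open>n\<close>.\<close>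
  define R where "R = min Z n"
  obtain A B DA where A: "\<And>p m. p < n \<Longrightarrow> A p m \<le> n" and B: "\<And>p m. p < n \<Longrightarrow> B p m \<le> n"
    and DA: "\<And>p m. p < n \<Longrightarrow> m < J \<Longrightarrow> DA p m \<le> n + J * 2 ^ l + 2 * J"
    and match: "\<And>s t p q. s < n \<Longrightarrow> t < n \<Longrightarrow> p < n \<Longrightarrow> q < n \<Longrightarrow> d s p \<le> J \<Longrightarrow> d t q \<le> J \<Longrightarrow>
      Z < d s t \<Longrightarrow> \<exists>j<J. A p j = B q j \<and> (\<forall>i<j. A p i \<noteq> B q i) \<and>
        d s t \<le> DA p j \<and> real (DA p j) \<le> (1 + \<epsilon>) * real (d s t)"
  proof (rule labels_exist[OF unit_graph J l_nat(1)[unfolded \<Delta>_def] eps \<mu>(1) J_def, folded Z_def], goal_cases)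
    case (1 A B DA)
    show ?case by (rule 1(1)[OF 1(2-5)])
  qed
  obtain ps idx where ps: "set ps \<subseteq> {..<n}" "length ps * J \<le> 2 * n" "\<And>v. v < n \<Longrightarrow> idx v \<le> length ps"
    and net: "\<And>v. J \<le> \<Delta> \<Longrightarrow> v < n \<Longrightarrow> idx v < length ps \<and> d v (ps ! idx v) \<le> J" and nonet: "\<not> J \<le> \<Delta> \<Longrightarrow> ps = []"
  proof (cases "J \<le> \<Delta>")
    case True
    obtain N where N: "separated J N" "\<And>v. v \<in> {..<n} \<Longrightarrow> \<exists>x\<in>N. d v x \<le> J" using net_exists[of J] by blast
    have N_n: "N \<subseteq> {..<n}" using N(1) by (simp add: separated_def)
    then have fin: "finite N" by (rule finite_subset) simp
    define ps where "ps = sorted_list_of_set N"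
    have ps: "set ps = N" "length ps = card N" using fin by (simp_all add: ps_def)
    have "\<exists>i. i < length ps \<and> d v (ps ! i) \<le> J" if "v < n" for v
      using N(2)[of v] that unfolding ps(1)[symmetric] by (metis in_set_conv_nth lessThan_iff)
    then obtain idx where "\<And>v. v < n \<Longrightarrow> idx v < length ps \<and> d v (ps ! idx v) \<le> J" by metis
    moreover have "card N * J \<le> 2 * n" using separated_card_le[OF N(1)] True by (simp add: \<Delta>_def)
    ultimately show ?thesis using that[of ps idx] N_n ps True by (auto simp: less_imp_le)
  qed (use that[of "[]" "\<lambda>_. 0"] in simp)
  define nbs where "nbs = map (\<lambda>v. sorted_list_of_set (adjs v)) [0..<n]"
  define labs where "labs = map (\<lambda>p. concat (map (\<lambda>m. [A p m, B p m, DA p m]) [0..<J])) ps"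
  define D where "D = layout n R nbs J idx labs"
  define w where "w = word_size 6 n"
  have adjs_n: "adjs v \<subseteq> {..<n}" for v using adj_in_V by (auto simp: adjs_def)
  then have fin_adjs: "finite (adjs v)" for v by (rule finite_subset) simp
  have nbs: "length nbs = n" "\<And>v. v < n \<Longrightarrow> set (nbs ! v) = adjs v" "\<And>v. v < n \<Longrightarrow> length (nbs ! v) = card (adjs v)"
    using fin_adjs by (simp_all add: nbs_def)
  have label_length: "length (concat (map (\<lambda>m. [A p m, B p m, DA p m]) [0..<J])) = 3 * J" for p
    by (subst length_concat_uniform[where k = 3]) auto
  have labs: "\<forall>xs\<in>set labs. length xs = 3 * J" "length labs = length ps"
    using label_length by (simp_all add: labs_def)
  have label_nth: "labs ! i ! (3 * m + c) = [A (ps ! i) m, B (ps ! i) m, DA (ps ! i) m] ! c"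
    if "i < length ps" "m < J" "c < 3" for i m c
    using nth_concat_uniform[of "map (\<lambda>m. [A (ps ! i) m, B (ps ! i) m, DA (ps ! i) m]) [0..<J]" 3 m c] that
    by (simp add: labs_def mult.commute)
  have len_nbs: "length (concat nbs) \<le> 2 * card E"
  proof -
    have "length (concat nbs) = (\<Sum>v\<leftarrow>[0..<n]. card (adjs v))"
      using fin_adjs by (simp add: length_concat nbs_def comp_def)
    also have "\<dots> = (\<Sum>v<n. card (adjs v))" by (simp add: interv_sum_list_conv_sum_set_nat lessThan_atLeast0)
    finally show ?thesis using sum_degrees_le by (simp add: adjs_def)
  qed
  have len_D: "length D = 3 + 3 * n + length (concat nbs) + length ps * (3 * J)"
    using length_layout[OF nbs(1) labs(1)] labs(2) by (simp add: D_def)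
  have n_le: "n \<le> 2 * card E" using card_V_le n by simp
  have len_n: "length D \<le> 3 + 9 * n + 2 * card E" using len_D len_nbs ps(2) by simp
  \<comment> \<open>The labels take at most \<open>6 * n\<close> words, so the total is at most
    \<open>3 + 9 * n + 2 * card E\<close>. Here \<open>n \<le> 2 * card E\<close> and
    \<open>card E\<close> is at least 1, which gives 3 + 18 + 2 = 23.\<close>
  then have space: "length D \<le> 23 * card E" using n_le n by linarith
  \<comment> \<open>Cell values and addresses are at most quadratic in \<open>n\<close>. Four
    further factors \<open>n + 1\<close>, each at least 3, provide the constant 81; hence the word
    size parameter 6.\<close>
  have "(3::nat) ^ 4 \<le> (n + 1) ^ 4" using n by (intro power_mono) auto
  then have "(n + 1) ^ 2 * 3 ^ 4 \<le> (n + 1) ^ 2 * (n + 1) ^ 4" by (rule mult_left_mono) simp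
  then have "(n + 1) ^ 2 * 81 \<le> (n + 1) ^ 6" by (simp flip: power_add)
  then have w: "(n + 1) ^ 2 * 81 \<le> 2 ^ w" using word_size_ge[of n 6] unfolding w_def by linarith
  have sq: "(n + 1) ^ 2 = n ^ 2 + 2 * n + 1" by (simp add: power2_eq_square)
  have cells: "length D + 2 * n + 3 < 2 ^ w" using len_n card_E_le w unfolding sq by simp
  have D_values: "x < 2 ^ w" if "x \<in> set D" for x
  proof -
    have range: "x \<le> length D + n \<or> x = R \<or> x \<in> set (concat nbs) \<or> x \<in> set (concat labs)"
      using set_layout[OF nbs(1) labs(1)] that ps(3) labs(2) unfolding D_def by metis
    have nb: "x < n" if "x \<in> set (concat nbs)"
      using that adjs_n nbs by (fastforce simp: in_set_conv_nth)
    have lb: "x \<le> n + n * (2 * n) + 2 * n" if x_label: "x \<in> set (concat labs)"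
    proof -
      obtain p m where pm: "p \<in> set ps" "m < J" "x \<in> {A p m, B p m, DA p m}"
        using x_label by (auto simp: labs_def)
      have "p < n" using pm(1) ps(1) by auto
      \<comment> \<open>Labels are present only in this case. It bounds \<open>J\<close>, and with
        it the stored distances, polynomially in \<open>n\<close> no matter how small \<epsilon>
        is.\<close>
      moreover have "J \<le> \<Delta>" using pm(1) nonet by fastforce
      then have "J * 2 ^ l \<le> n * (2 * n)" "J \<le> n" using l_nat Delta_n by (auto intro!: mult_mono)
      ultimately show ?thesis using pm A[of p m] B[of p m] DA[of p m] by auto
    qed
    have "x \<le> length D + n \<or> x \<le> n + n * (2 * n) + 2 * n"
      using range
    proof (elim disjE)
      assume "x \<in> set (concat nbs)"
      then show ?thesis using nb by (simp add: trans_le_add2)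
    next
      assume "x \<in> set (concat labs)"
      then show ?thesis using lb by blast
    qed (auto simp: R_def min_def)
    then show ?thesis
      using cells w unfolding sq by (auto simp: power2_eq_square)
  qed
  interpret oracle_layout w n R lam J D adjs
  proof
    show "3 + 3 * n \<le> length D" by (simp add: len_D)
    show "D ! 0 = length D" "D ! 1 = length D + n" "D ! 2 = R"
      unfolding D_def by (rule layout_header[OF nbs(1) labs(1)])+
    show "R \<le> n" by (simp add: R_def)
    show "adjs v \<subseteq> {..<n}" if "v < n" for v by (rule adjs_n)
    show "D ! (3 + 3 * v) \<le> D ! (4 + 3 * v) \<and> D ! (4 + 3 * v) \<le> length D \<and>
        D ! (4 + 3 * v) - D ! (3 + 3 * v) \<le> lam \<and>
        (!) D ` {D ! (3 + 3 * v)..<D ! (4 + 3 * v)} = adjs v" if "v < n" for v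
      using layout_record[OF nbs(1) labs(1) that, of R idx] layout_edges[OF nbs(1) labs(1) that, of R idx] nbs that
        card_neighbours_less[of v] by (simp add: D_def adjs_def)
  qed (use cells D_values in auto)
  have "0 < Z" using J by (simp add: Z_def)
  then have "1 \<le> real Z" by (simp add: Suc_le_eq)
  then obtain k where k: "real Z \<le> 2 ^ k" "2 ^ k \<le> 2 * real Z" using power_of_two_between by blast
  have reach: "reach adjs s i = {v \<in> {..<n}. d s v \<le> i}" if "s < n" for s i
    using reach_eq_ball[OF unit_graph that] by (simp add: adjs_def[abs_def])
  have card_reach: "card (reach adjs s R) \<le> lam ^ (k + 1)" if "s < n" for s
  proof -
    have "real Z \<le> real (2 ^ k)" using k(1) by simp
    then have "Z \<le> 2 ^ k" by (simp only: of_nat_le_iff)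
    then have "R \<le> 2 ^ k" by (simp add: R_def)
    then have "reach adjs s R \<subseteq> {v \<in> {..<n}. d s v \<le> 2 ^ k}" using reach[OF that] by auto
    then have "card (reach adjs s R) \<le> card {v \<in> {..<n}. d s v \<le> 2 ^ k}" by (intro card_mono) auto
    also have "\<dots> \<le> lam ^ (k + 1)" using card_ball_le[of s k] that by simp
    finally show ?thesis .
  qed
  have query: "runs w query (init_state D s t) (R * (lam ^ (k + 1) * (lam * 40 + 40) + 40) + J * 30 + 130)
      (\<lambda>\<sigma>. real (d s t) \<le> real (fst \<sigma> 0) \<and> real (fst \<sigma> 0) \<le> (1 + \<epsilon>) * real (d s t))"
    if st: "s < n" "t < n" for s t
  proof (rule query_runs[OF _ st card_reach[OF st(1)], where Q = "\<lambda>x. real (d s t) \<le> real x \<and> real x \<le> (1 + \<epsilon>) * real (d s t)"])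
    show "initial s t (init_state D s t)" by (simp add: initial_def init_state_def)
    show "real (d s t) \<le> real 0 \<and> real 0 \<le> (1 + \<epsilon>) * real (d s t)" if "s = t" using that by simp
  next
    fix i assume i: "t \<in> reach adjs s i" "\<forall>i'<i. t \<notin> reach adjs s i'"
    have "d s t = i" using i st reach[of s] by (metis (mono_tags, lifting) lessThan_iff linorder_neqE_nat mem_Collect_eq not_le order_refl)
    then show "real (d s t) \<le> real i \<and> real i \<le> (1 + \<epsilon>) * real (d s t)" using eps by (simp add: algebra_simps)
  next
    assume "t \<notin> reach adjs s R"
    then have "R < d s t" using reach st by simp
    \<comment> \<open>Distances are below \<open>n\<close>, so a search that fails at radius
      \<open>R\<close> was not cut short by the cap.\<close>
    then have far: "Z < d s t" using hop_dist_less_card[of s t] st by (simp add: R_def min_def split: if_splits)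
    have "J \<le> Z" by (simp add: Z_def)
    also have "Z \<le> \<Delta>" using far hop_dist_le_diameter[of s t] st by (simp add: \<Delta>_def)
    \<comment> \<open>A failed search thus guarantees that the net and the labels were
      stored.\<close>
    finally have "J \<le> \<Delta>" .
    then have idx: "idx v < length ps" "d v (ps ! idx v) \<le> J" if "v < n" for v
      using net[OF _ that] by auto
    have idx_n: "ps ! idx v < n" if "v < n" for v
      using subsetD[OF ps(1) nth_mem[OF idx(1)[OF that]]] by simp
    obtain j where j: "j < J" "A (ps ! idx s) j = B (ps ! idx t) j"
      "\<forall>i<j. A (ps ! idx s) i \<noteq> B (ps ! idx t) i" "d s t \<le> DA (ps ! idx s) j"
      "real (DA (ps ! idx s) j) \<le> (1 + \<epsilon>) * real (d s t)"
      using match[OF st idx_n[OF st(1)] idx_n[OF st(2)] idx(2)[OF st(1)] idx(2)[OF st(2)] far] by blast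
    define lab where "lab v = label_start n nbs J (idx v)" for v
    have lab: "lab v = D ! (5 + 3 * v)" "lab v + 3 * J \<le> length D" if "v < n" for v
      using layout_record(3)[OF nbs(1) labs(1) that, of R idx] layout_label(1)[OF nbs(1) labs(1), of "idx v" R idx]
        idx(1)[OF that] labs(2) by (simp_all add: D_def lab_def)
    have entry: "D ! (lab v + 3 * m + c) = [A (ps ! idx v) m, B (ps ! idx v) m, DA (ps ! idx v) m] ! c"
      if "v < n" "m < J" "c < 3" for v m c
    proof -
      have "3 * m + c < 3 * J" using that by linarith
      then show ?thesis
        using layout_label(2)[OF nbs(1) labs(1), of "idx v" "3 * m + c" R idx] label_nth[OF idx(1)[OF that(1)] that(2,3)]
          idx(1)[OF that(1)] labs(2) by (simp add: D_def lab_def add.assoc)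
    qed
    have AD: "D ! (lab s + 3 * m) = A (ps ! idx s) m" "D ! (lab t + 3 * m + 1) = B (ps ! idx t) m"
      "D ! (lab s + 3 * m + 2) = DA (ps ! idx s) m" if "m < J" for m
      using entry[OF st(1) that, of 0] entry[OF st(2) that, of 1] entry[OF st(1) that, of 2] by simp_all
    have before: "\<forall>i<j. D ! (lab s + 3 * i) \<noteq> D ! (lab t + 3 * i + 1)"
    proof (intro allI impI)
      fix i assume "i < j"
      then show "D ! (lab s + 3 * i) \<noteq> D ! (lab t + 3 * i + 1)" using j(1,3) AD(1,2)[of i] by simp
    qed
    show "\<exists>p q j. p = D ! (5 + 3 * s) \<and> p + 3 * J \<le> length D \<and>
      q = D ! (5 + 3 * t) \<and> q + 3 * J \<le> length D \<and> j < J \<and> D ! (p + 3 * j) = D ! (q + 3 * j + 1) \<and>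
      (\<forall>i<j. D ! (p + 3 * i) \<noteq> D ! (q + 3 * i + 1)) \<and>
      real (d s t) \<le> real (D ! (p + 3 * j + 2)) \<and> real (D ! (p + 3 * j + 2)) \<le> (1 + \<epsilon>) * real (d s t)"
    proof (intro exI conjI)
      show "lab s = D ! (5 + 3 * s)" "lab s + 3 * J \<le> length D" "lab t = D ! (5 + 3 * t)" "lab t + 3 * J \<le> length D"
        using lab st by auto
      show "j < J" by fact
      show "D ! (lab s + 3 * j) = D ! (lab t + 3 * j + 1)" using AD[OF j(1)] j(2) by simp
      show "\<forall>i<j. D ! (lab s + 3 * i) \<noteq> D ! (lab t + 3 * i + 1)" by (rule before)
      show "real (d s t) \<le> real (D ! (lab s + 3 * j + 2))" using AD(3)[OF j(1)] j(4) by simp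
      show "real (D ! (lab s + 3 * j + 2)) \<le> (1 + \<epsilon>) * real (d s t)" using AD(3)[OF j(1)] j(5) by simp
    qed
  qed
  have time: "real (R * (lam ^ (k + 1) * (lam * 40 + 40) + 40) + J * 30 + 130)
    \<le> query_time_bound 280 4 32 \<Delta> (doubling_dimension {..<n} E) \<epsilon>"
    unfolding doubling_dimension_def
    by (rule query_time_le[OF lam eps Delta l(2) \<mu>(2) J_def]) (use k in \<open>simp_all add: R_def Z_def\<close>)
  have "approx_distance_oracle w query D {..<n} E \<epsilon> (query_time_bound 280 4 32 \<Delta> (doubling_dimension {..<n} E) \<epsilon>)"
    unfolding approx_distance_oracle_def
  proof (intro conjI ballI)
    show "x < 2 ^ w" if "x \<in> set D" for x using D_values that .
    fix s t assume "s \<in> {..<n}" "t \<in> {..<n}"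
    then obtain \<tau> \<sigma> where run: "exec w query (init_state D s t) \<tau> \<sigma>"
      "\<tau> \<le> R * (lam ^ (k + 1) * (lam * 40 + 40) + 40) + J * 30 + 130"
      "real (d s t) \<le> real (fst \<sigma> 0)" "real (fst \<sigma> 0) \<le> (1 + \<epsilon>) * real (d s t)"
      using query[of s t] unfolding runs_def by auto
    have "real \<tau> \<le> real (R * (lam ^ (k + 1) * (lam * 40 + 40) + 40) + J * 30 + 130)"
      using run(2) by (simp only: of_nat_le_iff)
    then have "real \<tau> \<le> query_time_bound 280 4 32 \<Delta> (doubling_dimension {..<n} E) \<epsilon>" using time by linarith
    then show "\<exists>\<tau> \<sigma>. exec w query (init_state D s t) \<tau> \<sigma> \<and>
        real \<tau> \<le> query_time_bound 280 4 32 \<Delta> (doubling_dimension {..<n} E) \<epsilon> \<and>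
        real (d s t) \<le> real (fst \<sigma> 0) \<and> real (fst \<sigma> 0) \<le> (1 + \<epsilon>) * real (d s t)"
      using run by blast
  qed
  then show ?thesis using that[OF space] by (simp add: w_def \<Delta>_def)
qed

text \<open>Without edges not a single word may be stored. The program stops at its equality test,
  and 280 alone bounds the time because \<alpha> is nonnegative.\<close>

lemma oracle_singleton:
  fixes \<epsilon> :: real
  assumes "unit_graph {..<1} E"
  shows "approx_distance_oracle (word_size 6 1) query [] {..<1} E \<epsilon>
       (query_time_bound 280 4 32 (diameter {..<1} E) (doubling_dimension {..<1} E) \<epsilon>)"
proof -
  interpret unit_graph "{..<1}" E by fact
  have "0 \<le> doubling_dimension {..<1} E"
    using doubling_constant_pos by (simp add: doubling_dimension_def)
  then have "1 * 1 \<le> max 2 (log 2 (real (diameter {..<1} E))) powr (4 * doubling_dimension {..<1} E) *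
      max 2 (1 / \<epsilon>) powr (32 * (doubling_dimension {..<1} E)\<^sup>2)"
    by (intro mult_mono ge_one_powr_ge_zero) auto
  then have bound: "280 \<le> query_time_bound 280 4 32 (diameter {..<1} E) (doubling_dimension {..<1} E) \<epsilon>"
    by (simp add: query_time_bound_def)
  have "word_size 6 1 = 6" by (simp add: word_size_def)
  then have "runs (word_size 6 1) query (init_state [] 0 0) 280 (\<lambda>\<sigma>. fst \<sigma> 0 = 0)"
    unfolding query_def
    by (intro runs_If[where T' = 10] runs_Assign) (simp_all add: init_state_def)
  then obtain \<tau> \<sigma> where "exec (word_size 6 1) query (init_state [] 0 0) \<tau> \<sigma>" "\<tau> \<le> 280" "fst \<sigma> 0 = 0"
    unfolding runs_def by blast
  then show ?thesis
    using bound unfolding approx_distance_oracle_def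
    by (auto intro!: exI[of _ \<tau>] simp: split_paired_Ex[symmetric] simp del: split_paired_Ex intro: exI[of _ \<sigma>])
qed

theorem theorem5:
  "\<exists>(P :: com) (c :: nat) (C\<^sub>S :: real) (C\<^sub>T :: real) (a :: real) (b :: real). c \<ge> 1 \<and>
     (\<forall>(n :: nat) (E :: nat set set) (\<epsilon> :: real).
        unit_length_graph {..<n} E \<longrightarrow> connected_graph {..<n} E \<longrightarrow> \<epsilon> > 0 \<longrightarrow>
        (\<exists>D :: nat list.
           real (length D) \<le> C\<^sub>S * real (card E) \<and>
           approx_distance_oracle (word_size c n) P D {..<n} E \<epsilon>
             (query_time_bound C\<^sub>T a b (diameter {..<n} E) (doubling_dimension {..<n} E) \<epsilon>)))"
proof (rule exI[of _ query], rule exI[of _ 6], rule exI[of _ 23], rule exI[of _ 280],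
    rule exI[of _ 4], rule exI[of _ 32], intro conjI allI impI)
  fix n and E :: "nat set set" and \<epsilon> :: real
  assume "unit_length_graph {..<n} E" "connected_graph {..<n} E" and eps: "\<epsilon> > 0"
  then have graph: "unit_graph {..<n} E" and "n \<noteq> 0"
    by (auto simp: unit_graph_def unit_length_graph_def)
  show "\<exists>D. real (length D) \<le> 23 * real (card E) \<and>
      approx_distance_oracle (word_size 6 n) query D {..<n} E \<epsilon>
        (query_time_bound 280 4 32 (diameter {..<n} E) (doubling_dimension {..<n} E) \<epsilon>)"
  proof (cases "n = 1")
    case True
    then show ?thesis using oracle_singleton[of E \<epsilon>] graph by (intro exI[of _ "[]"]) simp
  next
    case False
    then have "n \<ge> 2" using \<open>n \<noteq> 0\<close> by simp
    from oracle_exists[OF graph this eps] obtain D where D: "length D \<le> 23 * card E"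
      "approx_distance_oracle (word_size 6 n) query D {..<n} E \<epsilon>
        (query_time_bound 280 4 32 (diameter {..<n} E) (doubling_dimension {..<n} E) \<epsilon>)" .
    have "real (length D) \<le> real (23 * card E)" using D(1) by (simp only: of_nat_le_iff)
    then show ?thesis using D(2) by auto
  qed
qed simp

end
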